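(* Let $P\subset\mathbb R^N$ be a rational polytope of dimension $M$, and let $v\in\mathbb R^N$, $\alpha\in\mathbb R$. Then: (1) $h_{P,v,\alpha}$ is a quasi-polynomial on $d\ge-\alpha$, and $h_{P,v,\alpha}(d)=0$ for $d<-\alpha$. (2) $\mathring h_{P,v,\alpha}$ is a quasi-polynomial on $d>-\alpha$, and $\mathring h_{P,v,\alpha}(d)=0$ for $d\le-\alpha$. (3) $H_{P,v,\alpha}(1/t)=(-1)^{M+1}\mathring H_{P,-v,-\alpha}(t)$ (as rational functions). (4) If $f_{P,v,\alpha}$ denotes the quasi-polynomial agreeing with $h_{P,v,\alpha}$ on $d\ge-\alpha$, then $f_{P,v,\alpha}(-i)=(-1)^M\mathring h_{P,-v,-\alpha}(i)$ for all $i\in\mathbb Z_{>\alpha}$.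
   Context: A rational polytope has vertices in $\mathbb Q^N$; $\mathrm{relint}(P)$ is its relative interior. For $d\in\mathbb Z$ define $h_{P,v,\alpha}(d):=\#\big((v+(d+\alpha)P)\cap\mathbb Z^N\big)$ and $\mathring h_{P,v,\alpha}(d):=\#\big((v+(d+\alpha)\,\mathrm{relint}(P))\cap\mathbb Z^N\big)$, with the conventions $sP=\emptyset$ for $s<0$ (so $0\cdot P=\{0\}$) and $s\cdot\mathrm{relint}(P)=\emptyset$ for $s\le0$. Their generating functions are $H_{P,v,\alpha}(t):=\sum_{i\in\mathbb Z}h_{P,v,\alpha}(i)t^i$ and $\mathring H_{P,v,\alpha}(t):=\sum_{i\in\mathbb Z}\mathring h_{P,v,\alpha}(i)t^i$. A quasi-polynomial is $f:\mathbb Z\to\mathbb C$ such that for some $N\ge1$ and polynomials $Q_0,\dots,Q_{N-1}$, $f(m)=Q_j(m)$ whenever $m\equiv j\pmod N$; a function is a quasi-polynomial on a set of integers $S$ if it agrees with a quasi-polynomial on $S$. *)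

theory Defs
  imports
    "HOL-Analysis.Analysis"
    "HOL-Computational_Algebra.Computational_Algebra"
    "HOL-Computational_Algebra.Field_as_Ring"
    "HOL-Number_Theory.Cong"
begin

definition rational_polytope :: "(real ^ 'n) set \<Rightarrow> bool" where
  "rational_polytope P \<longleftrightarrow>
     polytope P \<and> (\<forall>x. x extreme_point_of P \<longrightarrow> (\<forall>i. vec_nth x i \<in> \<rat>))"

definition int_lattice :: "(real ^ 'n) set" where
  "int_lattice = {x. \<forall>i. vec_nth x i \<in> \<int>}"

definition dilate :: "real \<Rightarrow> (real ^ 'n) set \<Rightarrow> (real ^ 'n) set" where
  "dilate s P = (if s < 0 then {} else (\<lambda>x. s *\<^sub>R x) ` P)"

definition dilate_relint :: "real \<Rightarrow> (real ^ 'n) set \<Rightarrow> (real ^ 'n) set" where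
  "dilate_relint s P = (if s \<le> 0 then {} else (\<lambda>x. s *\<^sub>R x) ` rel_interior P)"

text \<open>For bounded \<open>P\<close> the sets counted below are finite, so \<^const>\<open>card\<close> is the genuine
  number of lattice points.\<close>

definition count_pts :: "(real ^ 'n) set \<Rightarrow> real ^ 'n \<Rightarrow> real \<Rightarrow> int \<Rightarrow> nat" where
  "count_pts P v \<alpha> d = card ((\<lambda>x. v + x) ` dilate (of_int d + \<alpha>) P \<inter> int_lattice)"

definition count_relint_pts :: "(real ^ 'n) set \<Rightarrow> real ^ 'n \<Rightarrow> real \<Rightarrow> int \<Rightarrow> nat" where
  "count_relint_pts P v \<alpha> d = card ((\<lambda>x. v + x) ` dilate_relint (of_int d + \<alpha>) P \<inter> int_lattice)"

lemma eventually_neg_int_plus_neg: "\<forall>\<^sub>\<infinity>n::nat. of_int (- int n) + \<alpha> < (0::real)"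
  unfolding MOST_nat
proof (intro exI allI impI)
  fix n assume "nat \<lceil>\<alpha>\<rceil> < n"
  then show "of_int (- int n) + \<alpha> < 0" by simp linarith
qed

text \<open>The generating functions are Laurent series because both counting functions vanish at all
  sufficiently negative integers.\<close>

lift_definition gen_series :: "(real ^ 'n) set \<Rightarrow> real ^ 'n \<Rightarrow> real \<Rightarrow> complex fls"
  is "\<lambda>P v \<alpha> i. of_nat (count_pts P v \<alpha> i)"
  subgoal for P v \<alpha>
    by (rule MOST_mono[OF eventually_neg_int_plus_neg[of \<alpha>]]) (simp add: count_pts_def dilate_def)
  done

lift_definition gen_series_relint :: "(real ^ 'n) set \<Rightarrow> real ^ 'n \<Rightarrow> real \<Rightarrow> complex fls"
  is "\<lambda>P v \<alpha> i. of_nat (count_relint_pts P v \<alpha> i)"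
  subgoal for P v \<alpha>
    by (rule MOST_mono[OF eventually_neg_int_plus_neg[of \<alpha>]]) (simp add: count_relint_pts_def dilate_relint_def)
  done

definition quasi_polynomial :: "(int \<Rightarrow> complex) \<Rightarrow> bool" where
  "quasi_polynomial f \<longleftrightarrow>
     (\<exists>(N::nat) (Q :: nat \<Rightarrow> complex poly). N \<ge> 1 \<and>
        (\<forall>j<N. \<forall>m::int. [m = int j] (mod int N) \<longrightarrow> f m = poly (Q j) (of_int m)))"

definition quasi_polynomial_on :: "int set \<Rightarrow> (int \<Rightarrow> complex) \<Rightarrow> bool" where
  "quasi_polynomial_on S f \<longleftrightarrow> (\<exists>g. quasi_polynomial g \<and> (\<forall>m\<in>S. f m = g m))"

text \<open>The field of rational functions \<open>\<complex>(t)\<close> is the type \<^typ>\<open>complex poly fract\<close>. The first map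
  is its embedding into Laurent series (expansion at \<open>t = 0\<close>), the second is the substitution
  \<open>R(t) \<mapsto> R(1/t)\<close>. Both are written on the reduced fraction, but any fraction \<open>p/q\<close>
  representing \<open>R\<close> gives the same value.\<close>

definition ratfun_to_fls :: "complex poly fract \<Rightarrow> complex fls" where
  "ratfun_to_fls R = (case quot_of_fract R of (p, q) \<Rightarrow>
     fps_to_fls (fps_of_poly p) / fps_to_fls (fps_of_poly q))"

definition poly_at_inverse_t :: "complex poly \<Rightarrow> complex poly fract" where
  "poly_at_inverse_t p = poly (map_poly (\<lambda>c. to_fract [:c:]) p) (1 / to_fract [:0, 1:])"

definition ratfun_at_inverse_t :: "complex poly fract \<Rightarrow> complex poly fract" where
  "ratfun_at_inverse_t R = (case quot_of_fract R of (p, q) \<Rightarrow>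
     poly_at_inverse_t p / poly_at_inverse_t q)"

end

theory Submission
  imports Defs
begin

text \<open>
  Let \<open>C\<close> be the cone over \<open>{1} \<times> P\<close>. The numbers in question count the points of a coset of
  the lattice in \<open>C\<close>, and in the reflection of the relative interior of \<open>C\<close>, by height. Everything
  follows once the difference of the indicator of \<open>C\<close> and \<open>(-1)\<close>\<open>\<^sup>M\<^sup>+\<^sup>1\<close> times the indicator of
  \<open>- relint C\<close> is annihilated by the product of the difference operators \<open>1 - [w]\<close>, where \<open>w\<close> runs
  through integral generators of \<open>C\<close> of common height \<open>m\<close>: summing over the lattice points of a
  fixed height turns this product into a power of \<open>1 - [m]\<close>, and a function on \<open>\<int>\<close> annihilated by it
  is a quasi-polynomial.

  To prove this annihilation, add the generators one at a time. In the algebra of polyhedral indicators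
  under convolution with respect to the Euler characteristic, adding \<open>w\<close> convolves the indicator of \<open>C\<close>
  with the ray \<open>a = [\<real>\<^sub>\<ge>\<^sub>0 w]\<close> and the signed indicator of \<open>- relint C\<close> with \<open>b = - [\<real>\<^sub><\<^sub>0 w]\<close>. Since
  \<open>a - b = [\<real> w]\<close>, the new difference is the convolution of the old one with \<open>b\<close>, which commutes with
  translations, plus a function invariant under \<open>w\<close>, which \<open>1 - [w]\<close> kills. No triangulation is needed.
\<close>

section \<open>Jumps along a line\<close>

definition left_jump :: "(real \<Rightarrow> real) \<Rightarrow> real \<Rightarrow> real" where
  "left_jump \<psi> t = Lim (at_left t) \<psi> - \<psi> t"

text \<open>For an interval \<open>I\<close>, this is minus the Euler characteristic of \<open>I \<inter> {t. t > 0}\<close> whenever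
  \<open>I\<close> is bounded above; jumps are taken from the left so that no limit at infinity occurs.\<close>

definition jump_sum :: "(real \<Rightarrow> real) \<Rightarrow> real" where
  "jump_sum \<psi> = (\<Sum>t | t > 0 \<and> left_jump \<psi> t \<noteq> 0. left_jump \<psi> t)"

text \<open>The left limits make \<open>left_jump\<close> linear, and the finiteness makes
  \<open>jump_sum\<close> a genuine finite sum.\<close>

definition left_tame :: "(real \<Rightarrow> real) \<Rightarrow> bool" where
  "left_tame \<psi> \<longleftrightarrow> (\<forall>t. \<exists>l. (\<psi> \<longlongrightarrow> l) (at_left t)) \<and> finite {t. left_jump \<psi> t \<noteq> 0}"

lemma left_jump_eqI:
  assumes "(\<psi> \<longlongrightarrow> l) (at_left t)"
  shows "left_jump \<psi> t = l - \<psi> t"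
  using tendsto_Lim[OF _ assms] by (simp add: left_jump_def)

lemma left_jump_diff:
  assumes "left_tame \<psi>" "left_tame \<theta>"
  shows "left_jump (\<lambda>t. \<psi> t - \<theta> t) t = left_jump \<psi> t - left_jump \<theta> t"
proof -
  obtain l m where lm: "(\<psi> \<longlongrightarrow> l) (at_left t)" "(\<theta> \<longlongrightarrow> m) (at_left t)"
    using assms unfolding left_tame_def by meson
  show ?thesis
    using left_jump_eqI[OF tendsto_diff[OF lm]] left_jump_eqI[OF lm(1)] left_jump_eqI[OF lm(2)] by simp
qed

lemma left_tame_diff:
  assumes "left_tame \<psi>" "left_tame \<theta>"
  shows "left_tame (\<lambda>t. \<psi> t - \<theta> t)"
proof -
  have "{t. left_jump (\<lambda>t. \<psi> t - \<theta> t) t \<noteq> 0} \<subseteq> {t. left_jump \<psi> t \<noteq> 0} \<union> {t. left_jump \<theta> t \<noteq> 0}"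
    by (auto simp: left_jump_diff[OF assms])
  moreover have "finite ({t. left_jump \<psi> t \<noteq> 0} \<union> {t. left_jump \<theta> t \<noteq> 0})"
    using assms by (simp add: left_tame_def)
  moreover have "\<exists>l. ((\<lambda>t. \<psi> t - \<theta> t) \<longlongrightarrow> l) (at_left t)" for t
  proof -
    obtain l m where "(\<psi> \<longlongrightarrow> l) (at_left t)" "(\<theta> \<longlongrightarrow> m) (at_left t)"
      using assms unfolding left_tame_def by meson
    from tendsto_diff[OF this] show ?thesis ..
  qed
  ultimately show ?thesis
    unfolding left_tame_def using finite_subset by blast
qed

lemma left_tame_const_mult:
  assumes "left_tame \<psi>"
  shows "left_tame (\<lambda>t. c * \<psi> t)"
    and "left_jump (\<lambda>t. c * \<psi> t) t = c * left_jump \<psi> t"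
proof -
  have *: "left_jump (\<lambda>t. c * \<psi> t) t = c * left_jump \<psi> t" for t
  proof -
    obtain l where l: "(\<psi> \<longlongrightarrow> l) (at_left t)"
      using assms unfolding left_tame_def by meson
    show ?thesis
      using left_jump_eqI[OF tendsto_mult_left[OF l], of c] left_jump_eqI[OF l] by (simp add: right_diff_distrib)
  qed
  then show "left_jump (\<lambda>t. c * \<psi> t) t = c * left_jump \<psi> t" .
  have "{t. left_jump (\<lambda>t. c * \<psi> t) t \<noteq> 0} \<subseteq> {t. left_jump \<psi> t \<noteq> 0}"
    by (auto simp: *)
  moreover have "\<exists>l. ((\<lambda>t. c * \<psi> t) \<longlongrightarrow> l) (at_left t)" for t
  proof -
    obtain l where "(\<psi> \<longlongrightarrow> l) (at_left t)"
      using assms unfolding left_tame_def by meson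
    from tendsto_mult_left[OF this] show ?thesis ..
  qed
  ultimately show "left_tame (\<lambda>t. c * \<psi> t)"
    using assms unfolding left_tame_def using finite_subset by blast
qed

lemma jump_sum_superset:
  assumes "finite A" "{t. t > 0 \<and> left_jump \<psi> t \<noteq> 0} \<subseteq> A" "A \<subseteq> {0<..}"
  shows "jump_sum \<psi> = sum (left_jump \<psi>) A"
  unfolding jump_sum_def using assms by (intro sum.mono_neutral_left) auto

lemma jump_sum_diff:
  assumes "left_tame \<psi>" "left_tame \<theta>"
  shows "jump_sum (\<lambda>t. \<psi> t - \<theta> t) = jump_sum \<psi> - jump_sum \<theta>"
proof -
  define A where "A = {t. t > 0 \<and> (left_jump \<psi> t \<noteq> 0 \<or> left_jump \<theta> t \<noteq> 0)}"
  have "A \<subseteq> {t. left_jump \<psi> t \<noteq> 0} \<union> {t. left_jump \<theta> t \<noteq> 0}"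
    by (auto simp: A_def)
  then have "finite A"
    by (rule finite_subset) (use assms in \<open>simp add: left_tame_def\<close>)
  then have "jump_sum (\<lambda>t. \<psi> t - \<theta> t) = sum (left_jump (\<lambda>t. \<psi> t - \<theta> t)) A"
      "jump_sum \<psi> = sum (left_jump \<psi>) A" "jump_sum \<theta> = sum (left_jump \<theta>) A"
    by ((rule jump_sum_superset; auto simp: A_def left_jump_diff[OF assms])+)
  then show ?thesis
    by (simp add: left_jump_diff[OF assms] sum_subtractf)
qed

lemma jump_sum_const_mult:
  assumes "left_tame \<psi>"
  shows "jump_sum (\<lambda>t. c * \<psi> t) = c * jump_sum \<psi>"
proof (cases "c = 0")
  \<comment> \<open>For c = 0 the scaled function has no jumps while \<psi> may have some, so the
    two index sets differ.\<close>
  case True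
  have "left_jump (\<lambda>t. c * \<psi> t) t = 0" for t
    unfolding left_tame_const_mult(2)[OF assms] using True by simp
  then show ?thesis using True by (simp only: jump_sum_def) simp
next
  case False
  then show ?thesis
    by (simp add: jump_sum_def left_tame_const_mult(2)[OF assms] sum_distrib_left)
qed

lemma jump_sum_single:
  assumes "\<And>t. t > 0 \<Longrightarrow> t \<noteq> a \<Longrightarrow> left_jump \<psi> t = 0"
  shows "jump_sum \<psi> = (if a > 0 then left_jump \<psi> a else 0)"
proof -
  have "jump_sum \<psi> = sum (left_jump \<psi>) (if a > 0 then {a} else {})"
    using assms by (intro jump_sum_superset) auto
  then show ?thesis by simp
qed

section \<open>Jumps of indicators of intervals\<close>

definition upper_end :: "real set \<Rightarrow> real \<Rightarrow> bool" where
  "upper_end I t \<longleftrightarrow> t \<notin> I \<and> (\<exists>a<t. {a<..<t} \<subseteq> I)"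

definition lower_end :: "real set \<Rightarrow> real \<Rightarrow> bool" where
  "lower_end I t \<longleftrightarrow> t \<in> I \<and> (\<forall>s<t. s \<notin> I)"

text \<open>If no left neighbourhood of t misses I, then I has points below t arbitrarily close to
  t, and convexity fills the gaps between them.\<close>

lemma left_limit_indicator_convex:
  fixes I :: "real set"
  assumes "convex I"
  shows "(\<exists>a<t. {a<..<t} \<subseteq> I) \<and> (indicat_real I \<longlongrightarrow> 1) (at_left t) \<or>
         (\<exists>a<t. {a<..<t} \<inter> I = {}) \<and> (indicat_real I \<longlongrightarrow> 0) (at_left t)"
proof (cases "\<exists>a<t. {a<..<t} \<inter> I = {}")
  case True
  then obtain a where a: "a < t" "{a<..<t} \<inter> I = {}" by blast
  then have "eventually (\<lambda>s. indicat_real I s = 0) (at_left t)"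
    unfolding eventually_at_left_field by (intro exI[of _ a]) (auto simp: indicator_def)
  then show ?thesis using a tendsto_eventually by blast
next
  case False
  then obtain a where a: "a < t" "a \<in> I"
    by (metis disjoint_iff greaterThanLessThan_iff linordered_field_no_lb)
  have sub: "{a<..<t} \<subseteq> I"
  proof
    fix y assume y: "y \<in> {a<..<t}"
    with False obtain s where "s \<in> I" "y < s" "s < t"
      by (metis disjoint_iff greaterThanLessThan_iff)
    then show "y \<in> I"
      using a y assms mem_is_interval_1_I[of I a s y] by (simp add: is_interval_convex_1)
  qed
  with a have "eventually (\<lambda>s. indicat_real I s = 1) (at_left t)"
    unfolding eventually_at_left_field by (intro exI[of _ a]) (auto simp: indicator_def)
  then show ?thesis using a sub tendsto_eventually by blast
qed

text \<open>For a nondegenerate interval, a right end inside I and a left end outside I are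
  invisible from the left, since limit and value agree there. The other two kinds of ends jump; a
  single point counts as a lower end.\<close>

lemma left_jump_indicator_convex:
  fixes I :: "real set"
  assumes "convex I"
  shows "left_jump (indicat_real I) t = (if upper_end I t then 1 else if lower_end I t then - 1 else 0)"
  using left_limit_indicator_convex[OF assms, of t]
proof (elim disjE conjE exE)
  fix a assume a: "a < t" "{a<..<t} \<subseteq> I" and lim: "(indicat_real I \<longlongrightarrow> 1) (at_left t)"
  then have "(a + t) / 2 \<in> I" "(a + t) / 2 < t" by auto
  then have "\<not> lower_end I t" unfolding lower_end_def by blast
  then show ?thesis
    using a unfolding left_jump_eqI[OF lim] upper_end_def indicator_def by auto
next
  fix a assume a: "a < t" "{a<..<t} \<inter> I = {}" and lim: "(indicat_real I \<longlongrightarrow> 0) (at_left t)"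
  have "\<not> {b<..<t} \<subseteq> I" if "b < t" for b
  proof
    assume "{b<..<t} \<subseteq> I"
    moreover have "(max a b + t) / 2 \<in> {b<..<t}" "(max a b + t) / 2 \<in> {a<..<t}"
      using that a by auto
    ultimately show False using a by blast
  qed
  then have "\<not> upper_end I t" by (auto simp: upper_end_def)
  moreover have "lower_end I t" if "t \<in> I"
    unfolding lower_end_def
  proof (intro conjI allI impI notI that)
    \<comment> \<open>By convexity an earlier point s would put points of I into the gap
      \<open>{a<..<t}\<close>.\<close>
    fix s assume "s < t" "s \<in> I"
    moreover from this a have "s \<le> (max a s + t) / 2" "(max a s + t) / 2 \<le> t" by auto
    ultimately have "(max a s + t) / 2 \<in> I"
      using that assms mem_is_interval_1_I[of I s t "(max a s + t) / 2"] by (simp add: is_interval_convex_1)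
    moreover have "(max a s + t) / 2 \<in> {a<..<t}" using a \<open>s < t\<close> by auto
    ultimately show False using a by blast
  qed
  ultimately show ?thesis
    unfolding left_jump_eqI[OF lim] by (auto simp: lower_end_def indicator_def)
qed

text \<open>The smaller of two upper ends would lie between points of I on either side, hence in I,
  which an upper end does not.\<close>

lemma upper_end_unique:
  assumes "convex I" "upper_end I s" "upper_end I t"
  shows "s = t"
proof -
  have False if st: "s < t" "upper_end I s" "upper_end I t" for s t
  proof -
    obtain a b where ab: "a < s" "{a<..<s} \<subseteq> I" "b < t" "{b<..<t} \<subseteq> I" "s \<notin> I"
      using st by (auto simp: upper_end_def)
    have "(a + s) / 2 \<in> I"
      using ab(1) by (intro subsetD[OF ab(2)]) auto
    moreover have "(max b s + t) / 2 \<in> I"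
      using ab(3) st(1) by (intro subsetD[OF ab(4)]) auto
    moreover have "(a + s) / 2 \<le> s" "s \<le> (max b s + t) / 2" using ab st by auto
    ultimately have "s \<in> I"
      using assms mem_is_interval_1_I[of I "(a + s) / 2" "(max b s + t) / 2" s] by (simp add: is_interval_convex_1)
    with ab show False by simp
  qed
  with assms show ?thesis by (cases s t rule: linorder_cases) auto
qed

lemma lower_end_unique: "lower_end I s \<Longrightarrow> lower_end I t \<Longrightarrow> s = t"
  unfolding lower_end_def by (meson linorder_neqE_linordered_idom)

lemma finite_if_unique: "(\<And>s t. Q s \<Longrightarrow> Q t \<Longrightarrow> s = t) \<Longrightarrow> finite {t. Q t}"
proof (cases "\<exists>a. Q a")
  case True
  then obtain a where "Q a" ..
  moreover assume "\<And>s t. Q s \<Longrightarrow> Q t \<Longrightarrow> s = t"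
  ultimately have "{t. Q t} \<subseteq> {a}" by blast
  then show ?thesis by (rule finite_subset) simp
qed simp

lemma left_tame_indicator_convex:
  fixes I :: "real set"
  assumes "convex I"
  shows "left_tame (indicat_real I)"
proof -
  have "{t. left_jump (indicat_real I) t \<noteq> 0} \<subseteq> {t. upper_end I t} \<union> {t. lower_end I t}"
    by (auto simp: left_jump_indicator_convex[OF assms] split: if_splits)
  moreover have "finite {t. upper_end I t}"
    by (rule finite_if_unique) (rule upper_end_unique[OF assms])
  moreover have "finite {t. lower_end I t}"
    by (rule finite_if_unique) (rule lower_end_unique)
  ultimately have "finite {t. left_jump (indicat_real I) t \<noteq> 0}"
    by (meson finite_UnI finite_subset)
  then show ?thesis
    unfolding left_tame_def using left_limit_indicator_convex[OF assms] by blast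
qed

text \<open>A closed interval has no upper end in the above sense, so its only jump is -1 at its
  minimum, if there is one. The jump is counted exactly when this minimum is positive.\<close>

lemma jump_sum_indicator_closed:
  fixes I :: "real set"
  assumes "convex I" "closed I"
  shows "jump_sum (indicat_real I) = (if I \<noteq> {} \<and> I \<subseteq> {0<..} then - 1 else 0)"
proof -
  have upper: "\<not> upper_end I t" for t
  proof
    assume "upper_end I t"
    then obtain a where a: "a < t" "{a<..<t} \<subseteq> I" "t \<notin> I" by (auto simp: upper_end_def)
    then have "closure {a<..<t} \<subseteq> I" using assms by (meson closure_minimal)
    moreover have "t \<in> closure {a<..<t}" using a by simp
    ultimately show False using a by blast
  qed
  have jump: "left_jump (indicat_real I) t = (if lower_end I t then - 1 else 0)" for t
    by (simp add: left_jump_indicator_convex[OF assms(1)] upper)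
  show ?thesis
  proof (cases "\<exists>a. lower_end I a")
    case True
    then obtain a where a: "lower_end I a" ..
    have "jump_sum (indicat_real I) = (if a > 0 then - 1 else 0)"
    proof -
      have "left_jump (indicat_real I) t = 0" if "t \<noteq> a" for t
        using that lower_end_unique[OF a, of t] by (auto simp: jump)
      from jump_sum_single[of a "indicat_real I", OF this] show ?thesis
        using a by (simp add: jump)
    qed
    moreover have "I \<noteq> {} \<and> I \<subseteq> {0<..} \<longleftrightarrow> a > 0"
    proof (intro iffI conjI subsetI)
      show "a > 0" if "I \<noteq> {} \<and> I \<subseteq> {0<..}" using that a by (auto simp: lower_end_def)
      show "s \<in> {0<..}" if "a > 0" "s \<in> I" for s
      proof -
        have "\<not> s < a" using a that(2) unfolding lower_end_def by blast
        with that(1) show ?thesis by simp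
      qed
    qed (use a in \<open>auto simp: lower_end_def\<close>)
    ultimately show ?thesis by simp
  next
    case False
    then have "jump_sum (indicat_real I) = 0" by (simp add: jump_sum_def jump)
    \<comment> \<open>The infimum of such a closed I belongs to I and is a lower end.\<close>
    moreover have False if I: "I \<noteq> {}" "I \<subseteq> {0<..}"
    proof -
      have "bdd_below I" using I by (meson bdd_below.I greaterThan_iff less_imp_le subsetD)
      with I assms have "Inf I \<in> I" using closed_contains_Inf by blast
      moreover have "s \<notin> I" if "s < Inf I" for s
        using cInf_lower[OF _ \<open>bdd_below I\<close>, of s] that by auto
      ultimately show False using False by (auto simp: lower_end_def)
    qed
    ultimately show ?thesis by auto
  qed
qed

text \<open>An open interval has no lower end in the above sense. Its only jump is +1 at the
  supremum, which boundedness provides and which is positive exactly when I has positive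
  points.\<close>

lemma jump_sum_indicator_open:
  fixes I :: "real set"
  assumes "convex I" "open I" "bdd_above I"
  shows "jump_sum (indicat_real I) = (if I \<inter> {0<..} \<noteq> {} then 1 else 0)"
proof -
  have lower: "\<not> lower_end I t" for t
  proof
    assume t: "lower_end I t"
    then obtain e where "e > 0" "\<And>s. dist s t < e \<Longrightarrow> s \<in> I"
      using assms(2) by (auto simp: lower_end_def open_dist)
    then have "t - e / 2 \<in> I" "t - e / 2 < t" by (auto simp: dist_real_def)
    with t show False by (auto simp: lower_end_def)
  qed
  have jump: "left_jump (indicat_real I) t = (if upper_end I t then 1 else 0)" for t
    by (simp add: left_jump_indicator_convex[OF assms(1)] lower)
  show ?thesis
  proof (cases "I = {}")
    case True
    then have "\<not> upper_end I t" for t by (auto simp: upper_end_def)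
    then have "left_jump (indicat_real I) t = 0" for t by (simp add: jump)
    then show ?thesis using True by (simp only: jump_sum_def) simp
  next
    case False
    then obtain s where s: "s \<in> I" by blast
    have le: "y \<le> Sup I" if "y \<in> I" for y using that assms cSup_upper by blast
    have notin: "Sup I \<notin> I"
    proof
      assume "Sup I \<in> I"
      then obtain e where "e > 0" "\<And>y. dist y (Sup I) < e \<Longrightarrow> y \<in> I"
        using assms(2) by (auto simp: open_dist)
      then have "Sup I + e / 2 \<in> I" by (auto simp: dist_real_def)
      with le[of "Sup I + e / 2"] \<open>e > 0\<close> show False by simp
    qed
    have "{s<..<Sup I} \<subseteq> I"
    proof
      fix y assume y: "y \<in> {s<..<Sup I}"
      then obtain z where "z \<in> I" "y < z" using False less_cSupE by (metis greaterThanLessThan_iff)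
      then show "y \<in> I"
        using s y assms mem_is_interval_1_I[of I s z y] by (simp add: is_interval_convex_1)
    qed
    moreover have "s < Sup I" using s le notin by (metis less_le)
    ultimately have up: "upper_end I (Sup I)" using notin by (auto simp: upper_end_def)
    have "jump_sum (indicat_real I) = (if Sup I > 0 then 1 else 0)"
    proof -
      have "left_jump (indicat_real I) t = 0" if "t \<noteq> Sup I" for t
        using that upper_end_unique[OF assms(1) up, of t] by (auto simp: jump)
      from jump_sum_single[of "Sup I" "indicat_real I", OF this] show ?thesis
        using up by (simp add: jump)
    qed
    moreover have "I \<inter> {0<..} \<noteq> {} \<longleftrightarrow> Sup I > 0"
    proof
      assume "I \<inter> {0<..} \<noteq> {}"
      then show "Sup I > 0" using le by fastforce
    next
      assume "Sup I > 0"
      then obtain z where "z \<in> I" "0 < z" using False less_cSupE by metis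
      then show "I \<inter> {0<..} \<noteq> {}" by auto
    qed
    ultimately show ?thesis by simp
  qed
qed

lemma jump_sum_indicator_point:
  fixes I :: "real set"
  assumes "I \<subseteq> {a}"
  shows "jump_sum (indicat_real I) = (if I \<inter> {0<..} \<noteq> {} then - 1 else 0)"
proof -
  have "I = {} \<or> I = {a}" using assms by auto
  moreover from this have "convex I" "closed I" by auto
  ultimately show ?thesis
    using jump_sum_indicator_closed[of I] by auto
qed

section \<open>Difference operators on cones\<close>

definition tame :: "('a::real_vector \<Rightarrow> real) \<Rightarrow> bool" where
  "tame \<phi> \<longleftrightarrow> (\<forall>x w. left_tame (\<lambda>t. \<phi> (x + t *\<^sub>R w)))"

text \<open>Convolution of \<open>\<phi>\<close> with \<open>b = - [\<real>\<^sub><\<^sub>0 w]\<close>.\<close>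

definition line_jump :: "'a::real_vector \<Rightarrow> ('a \<Rightarrow> real) \<Rightarrow> 'a \<Rightarrow> real" where
  "line_jump w \<phi> x = jump_sum (\<lambda>t. \<phi> (x + t *\<^sub>R w))"

primrec iter_diff :: "'a::ab_group_add list \<Rightarrow> ('a \<Rightarrow> real) \<Rightarrow> 'a \<Rightarrow> real" where
  "iter_diff [] \<phi> = \<phi>"
| "iter_diff (w # ws) \<phi> = (\<lambda>x. iter_diff ws \<phi> x - iter_diff ws \<phi> (x - w))"

text \<open>Recursion matches adding one generator at a time. By
  \<open>rel_interior_convex_cone_hull\<close> this is the relative interior of the cone generated
  by the list.\<close>

primrec pos_cone :: "'a::real_vector list \<Rightarrow> 'a set" where
  "pos_cone [] = {0}"
| "pos_cone (w # ws) = {x + t *\<^sub>R w | x t. x \<in> pos_cone ws \<and> t > 0}"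

lemma tame_diff: "tame \<phi> \<Longrightarrow> tame \<theta> \<Longrightarrow> tame (\<lambda>x. \<phi> x - \<theta> x)"
  by (simp add: tame_def left_tame_diff)

lemma tame_const_mult: "tame \<phi> \<Longrightarrow> tame (\<lambda>x. c * \<phi> x)"
  by (simp add: tame_def left_tame_const_mult)

lemma tame_shift: 
  assumes "tame \<phi>"
  shows "tame (\<lambda>x. \<phi> (x - w))"
  unfolding tame_def
proof (intro allI)
  fix x v
  have "left_tame (\<lambda>t. \<phi> ((x - w) + t *\<^sub>R v))" using assms unfolding tame_def by blast
  then show "left_tame (\<lambda>t. \<phi> (x + t *\<^sub>R v - w))" by (simp add: algebra_simps)
qed

lemma convex_line_slice:
  assumes "convex K"
  shows "convex {t. x + t *\<^sub>R w \<in> K}"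
proof (rule convexI, clarify)
  fix s t u v :: real
  assume st: "x + s *\<^sub>R w \<in> K" "x + t *\<^sub>R w \<in> K" and uv: "0 \<le> u" "0 \<le> v" "u + v = 1"
  have "u *\<^sub>R (x + s *\<^sub>R w) + v *\<^sub>R (x + t *\<^sub>R w) = (u + v) *\<^sub>R x + (u * s + v * t) *\<^sub>R w"
    by (simp add: algebra_simps)
  with convexD[OF assms st uv] show "x + (u *\<^sub>R s + v *\<^sub>R t) *\<^sub>R w \<in> K"
    by (simp add: uv)
qed

lemma indicator_line_slice:
  "(\<lambda>t. indicat_real K (x + t *\<^sub>R w)) = indicat_real {t. x + t *\<^sub>R w \<in> K}"
  by (auto simp: indicator_def)

lemma tame_indicator_convex: "convex K \<Longrightarrow> tame (indicat_real K)"
  unfolding tame_def indicator_line_slice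
  by (intro allI left_tame_indicator_convex convex_line_slice)

lemma line_jump_diff:
  assumes "tame \<phi>" "tame \<theta>"
  shows "line_jump w (\<lambda>x. \<phi> x - \<theta> x) x = line_jump w \<phi> x - line_jump w \<theta> x"
  using assms unfolding line_jump_def tame_def by (simp add: jump_sum_diff)

lemma line_jump_shift: "line_jump w (\<lambda>x. \<phi> (x - v)) x = line_jump w \<phi> (x - v)"
  unfolding line_jump_def by (simp add: algebra_simps)

lemma line_jump_zero: "line_jump w (\<lambda>x. 0) x = 0"
  unfolding line_jump_def jump_sum_def by (simp add: left_jump_eqI[OF tendsto_const])

lemma iter_diff_tame: "tame \<phi> \<Longrightarrow> tame (iter_diff ws \<phi>)"
  by (induction ws) (simp_all add: tame_diff tame_shift)

text \<open>On tame functions \<open>line_jump w\<close> respects differences, and it commutes with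
  translations; hence it commutes with every factor 1 - [v].\<close>

lemma iter_diff_line_jump:
  assumes "tame \<phi>"
  shows "iter_diff ws (line_jump w \<phi>) = line_jump w (iter_diff ws \<phi>)"
proof (induction ws)
  case (Cons v ws)
  then show ?case
    using iter_diff_tame[OF assms, of ws] tame_shift[OF iter_diff_tame[OF assms, of ws], of v]
    by (simp add: line_jump_diff line_jump_shift fun_eq_iff)
qed simp

lemma iter_diff_add: "iter_diff ws (\<lambda>x. \<phi> x + \<theta> x) = (\<lambda>x. iter_diff ws \<phi> x + iter_diff ws \<theta> x)"
  by (induction ws) auto

text \<open>Translations commute, so each factor 1 - [v] preserves invariance under w.\<close>

lemma iter_diff_invariant:
  assumes "\<And>x. \<phi> (x - w) = \<phi> x"
  shows "iter_diff ws \<phi> (x - w) = iter_diff ws \<phi> x"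
proof (induction ws arbitrary: x)
  case (Cons v ws)
  from Cons[of x] Cons[of "x - v"] show ?case by (simp add: algebra_simps)
qed (simp add: assms)

section \<open>Adding one generator to a cone\<close>

lemma convex_cone_hull_insert:
  "convex_cone hull (insert w S) = {x + t *\<^sub>R w | x t. x \<in> convex_cone hull S \<and> t \<ge> 0}"
proof -
  have "convex_cone hull {w} = {t *\<^sub>R w | t. t \<ge> 0}"
    by (auto simp: convex_cone_hull_convex_hull_nonempty)
  then have "convex_cone hull (S \<union> {w}) = {x + t *\<^sub>R w | x t. x \<in> convex_cone hull S \<and> t \<ge> 0}"
    unfolding convex_cone_hull_Un by auto
  then show ?thesis by simp
qed

text \<open>Let I be the slice of C along the line through x in direction w. The left side asks
  whether I meets t \<le> 0, the first summand on the right whether I is nonempty. They differ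
  exactly when I is nonempty and positive, where the jump sum of the closed interval I is
  -1.\<close>

lemma line_jump_closed_cone:
  fixes C :: "'a::real_normed_vector set"
  assumes "convex C" "closed C"
  shows "indicat_real {x + t *\<^sub>R w | x t. x \<in> C \<and> t \<ge> 0} x =
    indicat_real {x. \<exists>t. x + t *\<^sub>R w \<in> C} x + line_jump w (indicat_real C) x"
proof -
  define I where "I = {t. x + t *\<^sub>R w \<in> C}"
  have "convex I" unfolding I_def by (rule convex_line_slice[OF assms(1)])
  moreover have "closed I"
    unfolding I_def using closed_vimage[OF assms(2), of "\<lambda>t. x + t *\<^sub>R w"]
    by (simp add: vimage_def continuous_intros)
  ultimately have "line_jump w (indicat_real C) x = (if I \<noteq> {} \<and> I \<subseteq> {0<..} then - 1 else 0)"
    unfolding line_jump_def indicator_line_slice I_def[symmetric] by (rule jump_sum_indicator_closed)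
  moreover have "x \<in> {x + t *\<^sub>R w | x t. x \<in> C \<and> t \<ge> 0} \<longleftrightarrow> (\<exists>t\<in>I. t \<le> 0)"
  proof
    assume "x \<in> {x + t *\<^sub>R w | x t. x \<in> C \<and> t \<ge> 0}"
    then obtain c t where "x = c + t *\<^sub>R w" "c \<in> C" "t \<ge> 0" by blast
    then show "\<exists>t\<in>I. t \<le> 0" by (intro bexI[of _ "- t"]) (auto simp: I_def)
  next
    assume "\<exists>t\<in>I. t \<le> 0"
    then obtain t where "x + t *\<^sub>R w \<in> C" "t \<le> 0" by (auto simp: I_def)
    then have "x = (x + t *\<^sub>R w) + (- t) *\<^sub>R w" "x + t *\<^sub>R w \<in> C" "- t \<ge> 0" by auto
    then show "x \<in> {x + t *\<^sub>R w | x t. x \<in> C \<and> t \<ge> 0}" by blast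
  qed
  moreover have "x \<in> {x. \<exists>t. x + t *\<^sub>R w \<in> C} \<longleftrightarrow> I \<noteq> {}"
    by (auto simp: I_def)
  moreover have "(\<exists>t\<in>I. t \<le> 0) \<longleftrightarrow> \<not> I \<subseteq> {0<..}"
    by (auto simp: subset_iff not_less)
  ultimately show ?thesis
    unfolding indicator_def by auto
qed

lemma convex_pos_cone: "convex (pos_cone ws)"
proof (induction ws)
  case (Cons w ws)
  show ?case
  proof (rule convexI)
    fix x y and u v :: real
    assume xy: "x \<in> pos_cone (w # ws)" "y \<in> pos_cone (w # ws)" and uv: "0 \<le> u" "0 \<le> v" "u + v = 1"
    then obtain a b s t where ab: "x = a + s *\<^sub>R w" "y = b + t *\<^sub>R w" "a \<in> pos_cone ws" "b \<in> pos_cone ws"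
      "s > 0" "t > 0" by auto
    have "u *\<^sub>R x + v *\<^sub>R y = (u *\<^sub>R a + v *\<^sub>R b) + (u * s + v * t) *\<^sub>R w"
      by (simp add: ab algebra_simps)
    moreover have "u *\<^sub>R a + v *\<^sub>R b \<in> pos_cone ws"
      using convexD[OF Cons] ab uv by blast
    moreover have "u * s + v * t > 0"
    proof (cases "u = 0")
      case False
      then have "u * s > 0" "v * t \<ge> 0" using uv ab by auto
      then show ?thesis by linarith
    qed (use uv ab in simp)
    ultimately show "u *\<^sub>R x + v *\<^sub>R y \<in> pos_cone (w # ws)" by auto
  qed
qed simp

lemma pos_cone_subset_span: "pos_cone ws \<subseteq> span (set ws)"
proof (induction ws)
  case (Cons w ws)
  then have "pos_cone ws \<subseteq> span (insert w (set ws))"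
    by (meson order_trans span_mono subset_insertI)
  then show ?case
    by (auto intro!: span_add span_scale intro: span_base)
qed simp

text \<open>Strictly positive coefficients survive small perturbations along the span; this yields
  open slices when w depends on the earlier generators.\<close>

lemma pos_cone_open_in_span:
  assumes "c \<in> pos_cone ws" "v \<in> span (set ws)"
  shows "\<exists>e>0. \<forall>r. \<bar>r\<bar> < e \<longrightarrow> c + r *\<^sub>R v \<in> pos_cone ws"
  using assms
proof (induction ws arbitrary: c v)
  case Nil
  then show ?case by (auto intro: exI[of _ 1])
next
  case (Cons w ws)
  obtain a t where a: "c = a + t *\<^sub>R w" "a \<in> pos_cone ws" "t > 0" using Cons.prems by auto
  obtain k where k: "v - k *\<^sub>R w \<in> span (set ws)"
    using Cons.prems(2) by (auto simp: span_insert)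
  obtain e where e: "e > 0" "\<And>r. \<bar>r\<bar> < e \<Longrightarrow> a + r *\<^sub>R (v - k *\<^sub>R w) \<in> pos_cone ws"
    using Cons.IH[OF a(2) k] by blast
  \<comment> \<open>The second bound keeps the coefficient t + r k of w positive; the summand 1
    avoids division by zero.\<close>
  define e' where "e' = min e (t / (\<bar>k\<bar> + 1))"
  show ?case
  proof (intro exI[of _ e'] conjI allI impI)
    show "e' > 0" using e a by (simp add: e'_def)
    fix r assume r: "\<bar>r\<bar> < e'"
    have "\<bar>r\<bar> * (\<bar>k\<bar> + 1) < t" using r by (simp add: e'_def pos_less_divide_eq)
    moreover have "\<bar>r * k\<bar> \<le> \<bar>r\<bar> * (\<bar>k\<bar> + 1)" by (simp add: abs_mult algebra_simps)
    ultimately have "t + r * k > 0" by linarith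
    moreover have "c + r *\<^sub>R v = (a + r *\<^sub>R (v - k *\<^sub>R w)) + (t + r * k) *\<^sub>R w"
      by (simp add: a algebra_simps)
    moreover have "a + r *\<^sub>R (v - k *\<^sub>R w) \<in> pos_cone ws" using e r by (simp add: e'_def)
    ultimately show "c + r *\<^sub>R v \<in> pos_cone (w # ws)" by auto
  qed
qed

text \<open>This bounds from above the slices of the reflected cone in the direction of a
  generator.\<close>

lemma pos_cone_height_nonneg:
  assumes "linear ht" "\<And>w. w \<in> set ws \<Longrightarrow> ht w > (0::real)" "c \<in> pos_cone ws"
  shows "ht c \<ge> 0"
  using assms(2,3)
proof (induction ws arbitrary: c)
  case Nil
  then show ?case using linear_0[OF assms(1)] by simp
next
  case (Cons w ws)
  then obtain a t where "c = a + t *\<^sub>R w" "a \<in> pos_cone ws" "t > 0" by auto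
  with Cons show ?case
    by (simp add: linear_add[OF assms(1)] linear_scale[OF assms(1)] order_less_imp_le)
qed

text \<open>The point x lies in the reflected new cone exactly when its slice I through the
  reflected old cone meets t > 0. If w is in the old span, I is open and bounded above, so the jump
  sum is +1 and the dimension is unchanged. Otherwise I has at most one point, the jump sum is -1,
  and the dimension grows by one. The sign follows the dimension in both cases.\<close>

lemma line_jump_neg_pos_cone:
  fixes ws :: "'a::euclidean_space list"
  assumes "linear ht" "\<And>v. v \<in> set (w # ws) \<Longrightarrow> ht v > (0::real)"
  shows "(- 1) ^ dim (set (w # ws)) * indicat_real {x. - x \<in> pos_cone (w # ws)} x =
    line_jump w (\<lambda>x. (- 1) ^ dim (set ws) * indicat_real {x. - x \<in> pos_cone ws} x) x"
proof -
  define K where "K = {x. - x \<in> pos_cone ws}"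
  define I where "I = {t. x + t *\<^sub>R w \<in> K}"
  have K: "convex K"
    using convex_linear_vimage[OF linear_uminus convex_pos_cone[of ws]] by (simp add: K_def vimage_def)
  then have I: "convex I" unfolding I_def by (rule convex_line_slice)
  have scale: "line_jump w (\<lambda>x. c * indicat_real K x) x = c * jump_sum (indicat_real I)" for c
    unfolding line_jump_def I_def indicator_line_slice[symmetric]
    using tame_indicator_convex[OF K] unfolding tame_def by (simp add: jump_sum_const_mult)
  have mem: "x \<in> {x. - x \<in> pos_cone (w # ws)} \<longleftrightarrow> I \<inter> {0<..} \<noteq> {}"
  proof
    assume "x \<in> {x. - x \<in> pos_cone (w # ws)}"
    then obtain c t where "- x = c + t *\<^sub>R w" "c \<in> pos_cone ws" "t > 0" by auto
    then have "- (x + t *\<^sub>R w) \<in> pos_cone ws" by (simp add: algebra_simps)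
    with \<open>t > 0\<close> show "I \<inter> {0<..} \<noteq> {}" by (auto simp: I_def K_def)
  next
    assume "I \<inter> {0<..} \<noteq> {}"
    then obtain t where t: "- (x + t *\<^sub>R w) \<in> pos_cone ws" "t > 0" by (auto simp: I_def K_def)
    then have "- (x + t *\<^sub>R w) + t *\<^sub>R w \<in> pos_cone (w # ws)"
      unfolding pos_cone.simps by blast
    then show "x \<in> {x. - x \<in> pos_cone (w # ws)}" by (simp del: pos_cone.simps)
  qed
  have "(if I \<inter> {0<..} \<noteq> {} then (- 1) ^ dim (set (w # ws)) else 0) =
      (- 1) ^ dim (set ws) * jump_sum (indicat_real I)"
  proof (cases "w \<in> span (set ws)")
    case True
    have "open I"
      unfolding open_dist
    proof
      fix t assume "t \<in> I"
      then have "- (x + t *\<^sub>R w) \<in> pos_cone ws" by (simp add: I_def K_def)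
      then obtain e where e: "e > 0" "\<And>r. \<bar>r\<bar> < e \<Longrightarrow> - (x + t *\<^sub>R w) + r *\<^sub>R w \<in> pos_cone ws"
        using pos_cone_open_in_span[OF _ True] by blast
      have "s \<in> I" if "dist s t < e" for s
        using e(2)[of "t - s"] that by (simp add: I_def K_def dist_real_def algebra_simps abs_minus_commute)
      with e show "\<exists>e>0. \<forall>y. dist y t < e \<longrightarrow> y \<in> I" by blast
    qed
    moreover have "bdd_above I"
    proof (rule bdd_aboveI)
      fix t assume "t \<in> I"
      then have "- (x + t *\<^sub>R w) \<in> pos_cone ws" by (simp add: I_def K_def)
      then have "ht (- (x + t *\<^sub>R w)) \<ge> 0"
        using pos_cone_height_nonneg[OF assms(1), of ws] assms(2) by auto
      then have "t * ht w \<le> - ht x"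
        by (simp add: linear_add[OF assms(1)] linear_scale[OF assms(1)] linear_neg[OF assms(1)] linear_diff[OF assms(1)])
      then show "t \<le> (- ht x) / ht w" using assms(2)[of w] by (simp only: pos_le_divide_eq list.set_intros)
    qed
    ultimately have "jump_sum (indicat_real I) = (if I \<inter> {0<..} \<noteq> {} then 1 else 0)"
      using jump_sum_indicator_open[OF I] by blast
    moreover have "dim (set (w # ws)) = dim (set ws)"
      using True by (simp add: dim_insert)
    ultimately show ?thesis by simp
  next
    case False
    have "s = t" if st: "s \<in> I" "t \<in> I" for s t
    \<comment> \<open>Two points of the slice differ by a nonzero multiple of w, which would force w
      into the span.\<close>
    proof (rule ccontr)
      assume "s \<noteq> t"
      have "- (x + s *\<^sub>R w) \<in> span (set ws)" "- (x + t *\<^sub>R w) \<in> span (set ws)"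
        using st pos_cone_subset_span[of ws] by (auto simp: I_def K_def)
      from span_diff[OF this] have "(t - s) *\<^sub>R w \<in> span (set ws)"
        by (simp add: algebra_simps)
      then have "w \<in> span (set ws)" using \<open>s \<noteq> t\<close> span_scale[of "(t - s) *\<^sub>R w" _ "1 / (t - s)"] by simp
      with False show False by blast
    qed
    then have "\<exists>a. I \<subseteq> {a}" by blast
    then have "jump_sum (indicat_real I) = (if I \<inter> {0<..} \<noteq> {} then - 1 else 0)"
      using jump_sum_indicator_point by blast
    moreover have "dim (set (w # ws)) = Suc (dim (set ws))"
      using False by (simp add: dim_insert)
    ultimately show ?thesis by simp
  qed
  moreover have "indicat_real {x. - x \<in> pos_cone (w # ws)} x = of_bool (I \<inter> {0<..} \<noteq> {})"
    by (simp only: indicator_def mem)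
  ultimately show ?thesis
    unfolding K_def[symmetric] scale by (cases "I \<inter> {0<..} = {}") (simp_all del: list.set pos_cone.simps)
qed

text \<open>For the cone over a polytope of dimension M the exponent is M + 1, the dimension of the
  linear span of the generators.\<close>

definition reciprocity_fun :: "'a::euclidean_space list \<Rightarrow> 'a \<Rightarrow> real" where
  "reciprocity_fun ws x = indicat_real (convex_cone hull (set ws)) x -
     (- 1) ^ dim (set ws) * indicat_real {x. - x \<in> pos_cone ws} x"

lemma tame_neg_pos_cone: "tame (\<lambda>x. c * indicat_real {x. - x \<in> pos_cone ws} x)"
proof -
  have "convex {x. - x \<in> pos_cone ws}"
    using convex_linear_vimage[OF linear_uminus convex_pos_cone[of ws]] by (simp add: vimage_def)
  then show ?thesis by (intro tame_const_mult tame_indicator_convex)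
qed

text \<open>Adding w gives a w-invariant \<theta> plus \<open>line_jump w\<close> of the previous
  function. The differences along ws kill the second summand, because they commute with
  \<open>line_jump w\<close>, and keep \<theta> invariant; the remaining factor 1 - [w] then kills
  the rest.\<close>

lemma iter_diff_reciprocity_fun:
  fixes ws :: "'a::euclidean_space list"
  assumes "linear ht" "\<And>w. w \<in> set ws \<Longrightarrow> ht w > (0::real)"
  shows "iter_diff ws (reciprocity_fun ws) = (\<lambda>x. 0)"
  using assms(2)
proof (induction ws)
  case Nil
  \<comment> \<open>Without generators both cones are {0}, and the sign is 1 because the dimension
    is 0.\<close>
  show ?case by (auto simp: reciprocity_fun_def indicator_def fun_eq_iff)
next
  case (Cons w ws)
  define C where "C = convex_cone hull (set ws)"
  define \<theta> where "\<theta> = indicat_real {x. \<exists>t. x + t *\<^sub>R w \<in> C}"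
  have C: "convex C" "closed C"
    unfolding C_def using polyhedron_convex_cone_hull[of "set ws"]
    by (auto intro: polyhedron_imp_convex polyhedron_imp_closed)
  have tame: "tame (indicat_real C)" "tame (\<lambda>x. (- 1) ^ dim (set ws) * indicat_real {x. - x \<in> pos_cone ws} x)"
    using C by (auto intro: tame_indicator_convex tame_neg_pos_cone)
  have eq: "reciprocity_fun ws =
      (\<lambda>x. indicat_real C x - (- 1) ^ dim (set ws) * indicat_real {x. - x \<in> pos_cone ws} x)"
    by (simp add: fun_eq_iff reciprocity_fun_def C_def)
  have "tame (reciprocity_fun ws)"
    unfolding eq by (rule tame_diff[OF tame])
  have "reciprocity_fun (w # ws) x = \<theta> x + line_jump w (reciprocity_fun ws) x" for x
  proof -
    have "line_jump w (reciprocity_fun ws) x = line_jump w (indicat_real C) x -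
        (- 1) ^ dim (set (w # ws)) * indicat_real {x. - x \<in> pos_cone (w # ws)} x"
      unfolding eq line_jump_diff[OF tame]
      using line_jump_neg_pos_cone[OF assms(1) Cons.prems, where x = x] by (simp only:)
    moreover have "indicat_real (convex_cone hull (set (w # ws))) x = \<theta> x + line_jump w (indicat_real C) x"
      using line_jump_closed_cone[OF C, of w x] by (simp add: convex_cone_hull_insert C_def \<theta>_def)
    ultimately show ?thesis
      unfolding reciprocity_fun_def[of "w # ws"] by linarith
  qed
  then have "reciprocity_fun (w # ws) = (\<lambda>x. \<theta> x + line_jump w (reciprocity_fun ws) x)" ..
  moreover have "iter_diff ws (reciprocity_fun ws) = (\<lambda>x. 0)"
    using Cons by simp
  then have "iter_diff ws (line_jump w (reciprocity_fun ws)) = (\<lambda>x. 0)"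
    unfolding iter_diff_line_jump[OF \<open>tame (reciprocity_fun ws)\<close>]
    by (simp only: line_jump_zero[abs_def])
  moreover have "\<theta> (x - w) = \<theta> x" for x
  proof -
    have "(\<exists>t. x - w + t *\<^sub>R w \<in> C) \<longleftrightarrow> (\<exists>t. x + t *\<^sub>R w \<in> C)"
    proof (intro iffI; elim exE)
      fix t assume "x - w + t *\<^sub>R w \<in> C"
      then have "x + (t - 1) *\<^sub>R w \<in> C" by (simp add: algebra_simps)
      then show "\<exists>t. x + t *\<^sub>R w \<in> C" ..
    next
      fix t assume "x + t *\<^sub>R w \<in> C"
      then have "x - w + (t + 1) *\<^sub>R w \<in> C" by (simp add: algebra_simps)
      then show "\<exists>t. x - w + t *\<^sub>R w \<in> C" ..
    qed
    then show ?thesis by (simp add: \<theta>_def indicator_def)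
  qed
  ultimately show ?case
    by (simp add: iter_diff_add iter_diff_invariant)
qed

section \<open>Counting lattice points by height\<close>

lemma rel_interior_convex_cone_hull:
  fixes ws :: "'a::euclidean_space list"
  shows "rel_interior (convex_cone hull (set ws)) = pos_cone ws"
proof (induction ws)
  case (Cons w ws)
  \<comment> \<open>The enlarged cone is the image under f of the old cone times a closed half-line;
    relative interiors commute with linear images and with products.\<close>
  define f :: "'a \<times> real \<Rightarrow> 'a" where "f = (\<lambda>(x, t). x + t *\<^sub>R w)"
  have lin: "linear f"
    by (auto simp: f_def linear_iff algebra_simps)
  have conv: "convex (convex_cone hull (set ws))"
    using convex_cone_convex_cone_hull[of "set ws"] by (simp add: convex_cone_def)
  have "convex_cone hull (set (w # ws)) = f ` ((convex_cone hull (set ws)) \<times> {0..})"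
    unfolding list.set convex_cone_hull_insert f_def by (auto simp: image_iff)
  also have "rel_interior \<dots> = f ` rel_interior ((convex_cone hull (set ws)) \<times> {0..})"
    using rel_interior_convex_linear_image[OF lin] conv by (metis convex_Times convex_real_interval(1))
  also have "\<dots> = f ` (pos_cone ws \<times> {0<..})"
    using conv by (simp add: rel_interior_Times Cons)
  also have "\<dots> = pos_cone (w # ws)"
    by (auto simp: f_def image_iff)
  finally show ?case .
qed simp

text \<open>Lifting to height m rather than 1 only rescales the generators, c (m, m p) = (c m) (1,
  p), and makes them integral when m is a common denominator.\<close>

lemma convex_cone_hull_homogenize:
  fixes V :: "'a::euclidean_space set"
  assumes "V \<noteq> {}" "m > (0::real)"
  shows "convex_cone hull ((\<lambda>p. (m, m *\<^sub>R p)) ` V) = cone hull ({1} \<times> (convex hull V))"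
proof -
  have lin: "linear (\<lambda>p::'a. (0::real, m *\<^sub>R p))"
    by (simp add: linear_iff scaleR_right_distrib)
  \<comment> \<open>The lifting map is affine, so it is split into a linear map and a translation
    before taking convex hulls.\<close>
  have "(\<lambda>p. (m, m *\<^sub>R p)) ` V = (+) (m, 0) ` (\<lambda>p. (0, m *\<^sub>R p)) ` V"
    by (simp add: image_image)
  then have "convex hull ((\<lambda>p. (m, m *\<^sub>R p)) ` V) = (+) (m, 0) ` (\<lambda>p. (0, m *\<^sub>R p)) ` (convex hull V)"
    by (simp only: convex_hull_translation convex_hull_linear_image[OF lin])
  then have hull: "convex hull ((\<lambda>p. (m, m *\<^sub>R p)) ` V) = (\<lambda>p. (m, m *\<^sub>R p)) ` (convex hull V)"
    by (simp add: image_image)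
  have "convex_cone hull ((\<lambda>p. (m, m *\<^sub>R p)) ` V) = {c *\<^sub>R (m, m *\<^sub>R p) | c p. c \<ge> 0 \<and> p \<in> convex hull V}"
    using assms(1) by (auto simp: convex_cone_hull_convex_hull_nonempty hull)
  also have "\<dots> = {c *\<^sub>R (1, p) | c p. c \<ge> 0 \<and> p \<in> convex hull V}" (is "?A = ?B")
  proof
    show "?A \<subseteq> ?B"
    proof
      fix x assume "x \<in> ?A"
      then obtain c p where "x = c *\<^sub>R (m, m *\<^sub>R p)" "c \<ge> 0" "p \<in> convex hull V" by blast
      then have "x = (c * m) *\<^sub>R (1, p)" "c * m \<ge> 0" "p \<in> convex hull V" using assms(2) by auto
      then show "x \<in> ?B" by blast
    qed
    show "?B \<subseteq> ?A"
    proof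
      fix x assume "x \<in> ?B"
      then obtain c p where "x = c *\<^sub>R (1, p)" "c \<ge> 0" "p \<in> convex hull V" by blast
      then have "x = (c / m) *\<^sub>R (m, m *\<^sub>R p)" "c / m \<ge> 0" "p \<in> convex hull V" using assms(2) by auto
      then show "x \<in> ?A" by blast
    qed
  qed
  also have "\<dots> = cone hull ({1} \<times> (convex hull V))"
    by (auto simp: cone_hull_expl)
  finally show ?thesis .
qed

lemma mem_cone_hull_homogenize:
  fixes P :: "'a::real_vector set"
  shows "(s::real, y) \<in> cone hull ({1} \<times> P) \<longleftrightarrow> s \<ge> 0 \<and> y \<in> (\<lambda>x. s *\<^sub>R x) ` P"
  by (auto simp: cone_hull_expl)

text \<open>The lifted points lie in a hyperplane missing the origin, so adjoining 0 raises the
  affine dimension by one and turns it into the linear dimension.\<close>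

lemma dim_homogenize:
  fixes V :: "'a::euclidean_space set"
  assumes "m > (0::real)"
  shows "int (dim ((\<lambda>p. (m, m *\<^sub>R p)) ` V)) = aff_dim V + 1"
proof -
  define W where "W = (\<lambda>p. (m, m *\<^sub>R p)) ` V"
  have "affine hull W \<subseteq> {x. fst x = m}"
  proof (rule hull_minimal)
    show "affine {x. fst x = m}" for m :: real
      unfolding affine_def by (auto simp flip: distrib_right)
  qed (auto simp: W_def)
  then have "0 \<notin> affine hull W" using assms by auto
  then have "aff_dim (insert 0 W) = aff_dim W + 1" by (simp add: aff_dim_insert)
  moreover have "aff_dim (insert 0 W) = int (dim (insert 0 W))"
    by (rule aff_dim_zero) (simp add: hull_inc)
  moreover have "aff_dim W = aff_dim V"
  proof -
    have lin: "linear (\<lambda>p::'a. (0::real, m *\<^sub>R p))"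
      by (simp add: linear_iff scaleR_right_distrib)
    have inj: "inj (\<lambda>p::'a. (0::real, m *\<^sub>R p))" using assms by (auto simp: inj_def)
    have "W = (+) (m, 0) ` (\<lambda>p. (0, m *\<^sub>R p)) ` V" by (simp add: image_image W_def)
    then show ?thesis
      by (simp only: aff_dim_translation_eq aff_dim_injective_linear_image[OF lin inj])
  qed
  moreover have "dim (insert 0 W) = dim W" by (simp add: dim_insert span_zero)
  ultimately show ?thesis by (simp add: W_def)
qed

section \<open>Lattice sums at a fixed height\<close>

lemma finite_bounded_int_lattice:
  fixes S :: "(real ^ 'n) set"
  assumes "bounded S"
  shows "finite (S \<inter> int_lattice)"
proof -
  obtain B where B: "\<And>x. x \<in> S \<Longrightarrow> norm x \<le> B" using assms by (auto simp: bounded_iff)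
  define F where "F = (of_int ` {- \<lceil>B\<rceil>..\<lceil>B\<rceil>} :: real set)"
  have "S \<inter> int_lattice \<subseteq> vec_lambda ` (PiE UNIV (\<lambda>_. F))"
  proof
    fix x assume x: "x \<in> S \<inter> int_lattice"
    have "x $ i \<in> F" for i
    proof -
      obtain k where k: "x $ i = of_int k" using x by (auto simp: int_lattice_def Ints_def)
      have "\<bar>x $ i\<bar> \<le> B" using B[of x] x component_le_norm_cart[of x i] by simp
      then have "k \<in> {- \<lceil>B\<rceil>..\<lceil>B\<rceil>}" unfolding k by (auto; linarith)
      then show ?thesis by (simp add: F_def k)
    qed
    then have "vec_nth x \<in> PiE UNIV (\<lambda>_. F)" by auto
    then show "x \<in> vec_lambda ` (PiE UNIV (\<lambda>_. F))"
      by (metis image_eqI vec_nth_inverse)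
  qed
  moreover have "finite (PiE (UNIV::'n set) (\<lambda>_. F))"
    by (intro finite_PiE) (auto simp: F_def)
  ultimately show ?thesis by (meson finite_imageI finite_subset)
qed

definition back_diff :: "int \<Rightarrow> (int \<Rightarrow> 'a::ab_group_add) \<Rightarrow> int \<Rightarrow> 'a" where
  "back_diff m f d = f d - f (d - m)"

text \<open>The sum runs over the coset of the integer lattice through (\<alpha>, - v), at height d
  + \<alpha>. Summing over the whole lattice makes a lattice translation a mere reindexing; under
  \<open>level_finite\<close> only finitely many terms count.\<close>

definition level_sum :: "real ^ 'n \<Rightarrow> real \<Rightarrow> (real \<times> (real ^ 'n) \<Rightarrow> real) \<Rightarrow> int \<Rightarrow> real" where
  "level_sum v \<alpha> \<phi> d = (\<Sum>\<^sub>\<infinity>z\<in>int_lattice. \<phi> (of_int d + \<alpha>, z - v))"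

definition level_finite :: "real ^ 'n \<Rightarrow> real \<Rightarrow> (real \<times> (real ^ 'n) \<Rightarrow> real) \<Rightarrow> bool" where
  "level_finite v \<alpha> \<phi> \<longleftrightarrow> (\<forall>d::int. finite {z\<in>int_lattice. \<phi> (of_int d + \<alpha>, z - v) \<noteq> 0})"

lemma infsum_diff_real:
  fixes f g :: "'a \<Rightarrow> real"
  assumes "f summable_on A" "g summable_on A"
  shows "(\<Sum>\<^sub>\<infinity>x\<in>A. f x - g x) = infsum f A - infsum g A"
proof -
  have "((\<lambda>x. - g x) has_sum - infsum g A) A"
    using assms(2) by (simp add: has_sum_uminus)
  from infsumI[OF has_sum_add[OF has_sum_infsum[OF assms(1)] this]] show ?thesis by simp
qed

lemma level_finite_diff:
  assumes "level_finite v \<alpha> \<phi>" "level_finite v \<alpha> \<theta>"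
  shows "level_finite v \<alpha> (\<lambda>x. \<phi> x - \<theta> x)"
    and "level_sum v \<alpha> (\<lambda>x. \<phi> x - \<theta> x) d = level_sum v \<alpha> \<phi> d - level_sum v \<alpha> \<theta> d"
proof -
  have "finite {z\<in>int_lattice. \<phi> (of_int d + \<alpha>, z - v) - \<theta> (of_int d + \<alpha>, z - v) \<noteq> 0}" for d :: int
  proof (rule finite_subset)
    show "finite ({z\<in>int_lattice. \<phi> (of_int d + \<alpha>, z - v) \<noteq> 0} \<union> {z\<in>int_lattice. \<theta> (of_int d + \<alpha>, z - v) \<noteq> 0})"
      using assms unfolding level_finite_def by simp
  qed auto
  then show "level_finite v \<alpha> (\<lambda>x. \<phi> x - \<theta> x)" by (simp add: level_finite_def)
  have "(\<lambda>z. \<phi> (of_int d + \<alpha>, z - v)) summable_on int_lattice"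
      "(\<lambda>z. \<theta> (of_int d + \<alpha>, z - v)) summable_on int_lattice"
    using assms by (auto simp: level_finite_def intro: finite_nonzero_values_imp_summable_on)
  then show "level_sum v \<alpha> (\<lambda>x. \<phi> x - \<theta> x) d = level_sum v \<alpha> \<phi> d - level_sum v \<alpha> \<theta> d"
    unfolding level_sum_def by (rule infsum_diff_real)
qed

lemma uminus_int_lattice: "z \<in> int_lattice \<Longrightarrow> - z \<in> int_lattice"
  by (simp add: int_lattice_def)

lemma bij_betw_int_lattice_diff:
  assumes "u \<in> int_lattice"
  shows "bij_betw (\<lambda>z. z - u) int_lattice int_lattice"
  using assms by (intro bij_betwI[where g = "\<lambda>z. z + u"]) (auto simp: int_lattice_def)

text \<open>Translation by an integral w permutes the coset and moves heights by m.\<close>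

lemma level_shift:
  assumes "fst w = real_of_int m" "snd w \<in> int_lattice"
  shows "level_finite v \<alpha> \<phi> \<Longrightarrow> level_finite v \<alpha> (\<lambda>x. \<phi> (x - w))"
    and "level_sum v \<alpha> (\<lambda>x. \<phi> (x - w)) d = level_sum v \<alpha> \<phi> (d - m)"
proof -
  have eq: "\<phi> ((of_int d + \<alpha>, z - v) - w) = \<phi> (of_int (d - m) + \<alpha>, (z - snd w) - v)" for d :: int and z
    using assms(1) by (cases w) (simp add: algebra_simps)
  note bij = bij_betw_int_lattice_diff[OF assms(2)]
  show "level_finite v \<alpha> (\<lambda>x. \<phi> (x - w))" if fin: "level_finite v \<alpha> \<phi>"
    unfolding level_finite_def eq
  proof
    fix d :: int
    have "{z\<in>int_lattice. \<phi> (of_int (d - m) + \<alpha>, (z - snd w) - v) \<noteq> 0} \<subseteq>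
      (\<lambda>z. z + snd w) ` {z\<in>int_lattice. \<phi> (of_int (d - m) + \<alpha>, z - v) \<noteq> 0}"
    proof
      fix z assume z: "z \<in> {z\<in>int_lattice. \<phi> (of_int (d - m) + \<alpha>, (z - snd w) - v) \<noteq> 0}"
      then have "z - snd w \<in> int_lattice" using bij by (auto simp: bij_betw_def)
      with z show "z \<in> (\<lambda>z. z + snd w) ` {z\<in>int_lattice. \<phi> (of_int (d - m) + \<alpha>, z - v) \<noteq> 0}"
        by (intro image_eqI[of _ _ "z - snd w"]) auto
    qed
    then show "finite {z\<in>int_lattice. \<phi> (of_int (d - m) + \<alpha>, (z - snd w) - v) \<noteq> 0}"
      using fin unfolding level_finite_def by (meson finite_imageI finite_subset)
  qed
  show "level_sum v \<alpha> (\<lambda>x. \<phi> (x - w)) d = level_sum v \<alpha> \<phi> (d - m)"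
    unfolding level_sum_def eq
    by (rule infsum_reindex_bij_betw[OF bij, of "\<lambda>z. \<phi> (of_int (d - m) + \<alpha>, z - v)"])
qed

text \<open>All generators have the same height m, so every factor 1 - [w] becomes the same operator
  \<open>back_diff m\<close>.\<close>

lemma level_sum_iter_diff:
  assumes "level_finite v \<alpha> \<phi>"
    and "\<And>w. w \<in> set ws \<Longrightarrow> fst w = real_of_int m \<and> snd w \<in> int_lattice"
  shows "level_finite v \<alpha> (iter_diff ws \<phi>) \<and>
    level_sum v \<alpha> (iter_diff ws \<phi>) = (back_diff m ^^ length ws) (level_sum v \<alpha> \<phi>)"
  using assms(2)
proof (induction ws)
  case Nil
  then show ?case using assms(1) by simp
next
  case (Cons w ws)
  then have IH: "level_finite v \<alpha> (iter_diff ws \<phi>)"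
      "level_sum v \<alpha> (iter_diff ws \<phi>) = (back_diff m ^^ length ws) (level_sum v \<alpha> \<phi>)"
    and w: "fst w = real_of_int m" "snd w \<in> int_lattice" by auto
  note shift = level_shift(1)[OF w IH(1)]
  have "level_sum v \<alpha> (iter_diff (w # ws) \<phi>) d = back_diff m ((back_diff m ^^ length ws) (level_sum v \<alpha> \<phi>)) d" for d
    unfolding iter_diff.simps level_finite_diff(2)[OF IH(1) shift] level_shift(2)[OF w] IH(2) back_diff_def[of _ _ d] ..
  then have "level_sum v \<alpha> (iter_diff (w # ws) \<phi>) = (back_diff m ^^ length (w # ws)) (level_sum v \<alpha> \<phi>)"
    by (simp add: fun_eq_iff)
  then show ?case
    by (simp add: level_finite_diff(1)[OF IH(1) shift])
qed

lemma infsum_indicator_finite: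
  assumes "finite {z\<in>L. Q z}"
  shows "(\<Sum>\<^sub>\<infinity>z\<in>L. of_bool (Q z) :: real) = card {z\<in>L. Q z}"
proof -
  have "(\<Sum>\<^sub>\<infinity>z\<in>L. of_bool (Q z) :: real) = (\<Sum>\<^sub>\<infinity>z\<in>{z\<in>L. Q z}. 1)"
    by (rule infsum_cong_neutral) auto
  then show ?thesis using assms by simp
qed

lemma common_denominator:
  fixes V :: "(real ^ 'n) set"
  assumes "finite V" "\<And>x i. x \<in> V \<Longrightarrow> x $ i \<in> \<rat>"
  shows "\<exists>m::nat. m \<ge> 1 \<and> (\<forall>x\<in>V. real m *\<^sub>R x \<in> int_lattice)"
proof -
  define Q where "Q = (\<lambda>(x, i). x $ i) ` (V \<times> (UNIV :: 'n set))"
  have "finite Q" "Q \<subseteq> \<rat>" using assms by (auto simp: Q_def)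
  then have "\<exists>m::nat. m \<ge> 1 \<and> (\<forall>q\<in>Q. real m * q \<in> \<int>)"
  proof (induction Q rule: finite_induct)
    case (insert q Q)
    then obtain m where m: "m \<ge> 1" "\<forall>q\<in>Q. real m * q \<in> \<int>" by auto
    obtain a b where ab: "q = real_of_int a / real b" "b > 0"
      using insert.prems by (auto simp: Rats_eq_int_div_nat)
    have "real (m * b) * q = of_int (int m * a)" using ab by simp
    then have "real (m * b) * q \<in> \<int>" by (metis Ints_of_int)
    moreover have "real (m * b) * r \<in> \<int>" if "r \<in> Q" for r
    proof -
      have "real (m * b) * r = of_nat b * (real m * r)" by simp
      with m that show ?thesis by (metis Ints_mult Ints_of_nat)
    qed
    moreover have "m * b \<ge> 1" using m ab by (simp add: Suc_le_eq)
    ultimately show ?case by blast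
  qed auto
  then show ?thesis by (auto simp: Q_def int_lattice_def)
qed

text \<open>This is reciprocity in operator form. Here m is a common denominator of the vertices and
  k the length of a list of the lifted vertices; both depend on P alone, so they also serve the
  reflected data.\<close>

lemma back_diff_reciprocity:
  fixes P :: "(real ^ 'n) set"
  assumes "rational_polytope P" and "aff_dim P = int M"
  shows "\<exists>m k. m \<ge> 1 \<and> (\<forall>v \<alpha>. (back_diff (int m) ^^ k) (\<lambda>d. real (count_pts P v \<alpha> d) -
      (- 1) ^ (M + 1) * real (count_relint_pts P (- v) (- \<alpha>) (- d))) = (\<lambda>_. 0))"
proof -
  define V where "V = {x. x extreme_point_of P}"
  have poly: "polytope P" using assms by (simp add: rational_polytope_def)
  have fin: "finite V"
    unfolding V_def using poly by (intro finite_polyhedron_extreme_points polytope_imp_polyhedron)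
  have hull: "P = convex hull V"
    unfolding V_def using poly by (intro Krein_Milman_Minkowski polytope_imp_compact polytope_imp_convex)
  have "P \<noteq> {}" using assms(2) by auto
  then have "V \<noteq> {}" using hull by auto
  obtain m :: nat where m: "m \<ge> 1" "\<forall>x\<in>V. real m *\<^sub>R x \<in> int_lattice"
    using common_denominator[OF fin] assms(1) by (auto simp: rational_polytope_def V_def)
  obtain ws where ws: "set ws = (\<lambda>p. (real m, real m *\<^sub>R p)) ` V"
    using fin by (meson finite_imageI finite_list)
  define C where "C = convex_cone hull (set ws)"
  have C: "C = cone hull ({1} \<times> P)"
    unfolding C_def ws hull using \<open>V \<noteq> {}\<close> m(1) by (intro convex_cone_hull_homogenize) auto
  \<comment> \<open>The slice of C at height s is the dilate s P, empty for negative s as in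
    \<open>dilate\<close>.\<close>
  have mem_C: "(s, y) \<in> C \<longleftrightarrow> y \<in> dilate s P" for s y
    unfolding C mem_cone_hull_homogenize by (auto simp: dilate_def)
  \<comment> \<open>The relative interior of C contains only positive heights, which matches the
    convention of \<open>dilate_relint\<close> at s = 0.\<close>
  have mem_pos: "(s, y) \<in> pos_cone ws \<longleftrightarrow> y \<in> dilate_relint s P" for s y
    unfolding rel_interior_convex_cone_hull[symmetric] C_def[symmetric] C
    using rel_interior_convex_cone_aux[OF polytope_imp_convex[OF poly], of s y]
    by (auto simp: dilate_relint_def)
  have "int (dim (set ws)) = int (M + 1)"
    unfolding ws using dim_homogenize[of "real m" V] m(1) assms(2)
    by (simp add: hull aff_dim_convex_hull)
  then have dim: "dim (set ws) = M + 1" by linarith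
  have ht: "fst w > 0" if "w \<in> set ws" for w using that m(1) by (auto simp: ws)
  have zero: "iter_diff ws (reciprocity_fun ws) = (\<lambda>_. 0)"
    using iter_diff_reciprocity_fun[OF linear_fst ht] .
  have step: "fst w = real_of_int (int m) \<and> snd w \<in> int_lattice" if "w \<in> set ws" for w
    using that m(2) by (auto simp: ws)
  have bounded: "bounded (dilate s P)" for s
    using polytope_imp_bounded[OF poly] by (simp add: dilate_def bounded_scaling)
  have "(back_diff (int m) ^^ length ws) (\<lambda>d. real (count_pts P v \<alpha> d) -
      (- 1) ^ (M + 1) * real (count_relint_pts P (- v) (- \<alpha>) (- d))) = (\<lambda>_. 0)" for v \<alpha>
  proof -
    have fin1: "finite {z \<in> int_lattice. (s, z - v) \<in> C}" for s
    proof -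
      have "{z \<in> int_lattice. (s, z - v) \<in> C} = (+) v ` dilate s P \<inter> int_lattice"
        unfolding mem_C by (auto simp: image_iff) (metis add_diff_cancel_left' diff_add_cancel add.commute)
      then show ?thesis using finite_bounded_int_lattice bounded_translation[OF bounded] by metis
    qed
    have fin2: "finite {z \<in> int_lattice. - (s, z - v) \<in> pos_cone ws}" for s
    proof -
      have "dilate_relint (- s) P \<subseteq> dilate (- s) P"
        using rel_interior_subset[of P] by (auto simp: dilate_relint_def dilate_def)
      then have "bounded (dilate_relint (- s) P)" using bounded bounded_subset by blast
      then have "bounded ((\<lambda>y. v - y) ` dilate_relint (- s) P)"
        using bounded_translation[of "uminus ` dilate_relint (- s) P" v] by (simp add: image_image)
      then have "finite ((\<lambda>y. v - y) ` dilate_relint (- s) P \<inter> int_lattice)"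
        by (rule finite_bounded_int_lattice)
      moreover have "{z \<in> int_lattice. - (s, z - v) \<in> pos_cone ws} \<subseteq>
          (\<lambda>y. v - y) ` dilate_relint (- s) P \<inter> int_lattice"
      proof
        fix z assume "z \<in> {z \<in> int_lattice. - (s, z - v) \<in> pos_cone ws}"
        then have z: "z \<in> int_lattice" and "- (s, z - v) \<in> pos_cone ws" by auto
        then have "v - z \<in> dilate_relint (- s) P" using mem_pos[of "- s" "v - z"] by simp
        then have "v - (v - z) \<in> (\<lambda>y. v - y) ` dilate_relint (- s) P" by (rule imageI)
        with z show "z \<in> (\<lambda>y. v - y) ` dilate_relint (- s) P \<inter> int_lattice" by simp
      qed
      ultimately show ?thesis by (meson finite_subset)
    qed
    have count1: "level_sum v \<alpha> (indicat_real C) d = real (count_pts P v \<alpha> d)" for d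
    proof -
      have "{z \<in> int_lattice. (of_int d + \<alpha>, z - v) \<in> C} = (\<lambda>x. v + x) ` dilate (of_int d + \<alpha>) P \<inter> int_lattice"
        unfolding mem_C by (auto simp: image_iff) (metis add_diff_cancel_left' diff_add_cancel add.commute)
      then show ?thesis
        unfolding level_sum_def indicator_def infsum_indicator_finite[OF fin1] count_pts_def by simp
    qed
    have count2: "level_sum v \<alpha> (indicat_real {x. - x \<in> pos_cone ws}) d =
        real (count_relint_pts P (- v) (- \<alpha>) (- d))" for d
    proof -
      \<comment> \<open>Negation turns points over v at height d + \<alpha> of the reflected cone
        into points over - v at height - d - \<alpha> of the cone itself.\<close>
      have "bij_betw uminus {z \<in> int_lattice. - (of_int d + \<alpha>, z - v) \<in> pos_cone ws}
         ((\<lambda>x. - v + x) ` dilate_relint (of_int (- d) + - \<alpha>) P \<inter> int_lattice)"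
      proof (rule bij_betwI[where g = uminus], goal_cases)
        case 1
        show ?case
        proof
          fix z assume "z \<in> {z \<in> int_lattice. - (of_int d + \<alpha>, z - v) \<in> pos_cone ws}"
          then have z: "z \<in> int_lattice" "v - z \<in> dilate_relint (of_int (- d) + - \<alpha>) P"
            using mem_pos[of "- (of_int d + \<alpha>)" "v - z"] by auto
          from z(2) have "- v + (v - z) \<in> (\<lambda>x. - v + x) ` dilate_relint (of_int (- d) + - \<alpha>) P"
            by (rule imageI)
          with z(1) show "- z \<in> (\<lambda>x. - v + x) ` dilate_relint (of_int (- d) + - \<alpha>) P \<inter> int_lattice"
            by (simp add: int_lattice_def)
        qed
      next
        case 2
        show ?case
        proof
          fix z assume "z \<in> (\<lambda>x. - v + x) ` dilate_relint (of_int (- d) + - \<alpha>) P \<inter> int_lattice"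
          then obtain x where "z = - v + x" "x \<in> dilate_relint (of_int (- d) + - \<alpha>) P" "z \<in> int_lattice" by auto
          moreover from this have "- z \<in> int_lattice" by (intro uminus_int_lattice)
          ultimately show "- z \<in> {z \<in> int_lattice. - (of_int d + \<alpha>, z - v) \<in> pos_cone ws}"
            using mem_pos[of "- (of_int d + \<alpha>)" x] by simp
        qed
      qed auto
      from bij_betw_same_card[OF this] show ?thesis
        unfolding level_sum_def indicator_def mem_Collect_eq infsum_indicator_finite[OF fin2] count_relint_pts_def by simp
    qed
    have lf1: "level_finite v \<alpha> (indicat_real C)"
      using fin1 by (simp add: level_finite_def indicator_def)
    have lf2: "level_finite v \<alpha> (\<lambda>x. (- 1) ^ (M + 1) * indicat_real {x. - x \<in> pos_cone ws} x)"
      unfolding level_finite_def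
    proof
      fix d :: int
      show "finite {z\<in>int_lattice. (- 1) ^ (M + 1) * indicat_real {x. - x \<in> pos_cone ws} (of_int d + \<alpha>, z - v) \<noteq> 0}"
        using fin2[of "of_int d + \<alpha>"] by (simp add: indicator_def)
    qed
    have rf: "reciprocity_fun ws =
        (\<lambda>x. indicat_real C x - (- 1) ^ (M + 1) * indicat_real {x. - x \<in> pos_cone ws} x)"
      by (simp add: fun_eq_iff reciprocity_fun_def C_def dim)
    have "level_sum v \<alpha> (reciprocity_fun ws) d = real (count_pts P v \<alpha> d) -
      (- 1) ^ (M + 1) * real (count_relint_pts P (- v) (- \<alpha>) (- d))" for d
      unfolding rf level_finite_diff(2)[OF lf1 lf2] count1 count2[symmetric]
      by (simp only: level_sum_def infsum_cmult_right')
    then have ls: "level_sum v \<alpha> (reciprocity_fun ws) = (\<lambda>d. real (count_pts P v \<alpha> d) -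
      (- 1) ^ (M + 1) * real (count_relint_pts P (- v) (- \<alpha>) (- d)))" ..
    have lf: "level_finite v \<alpha> (reciprocity_fun ws)"
      unfolding rf by (rule level_finite_diff(1)[OF lf1 lf2])
    have "level_sum v \<alpha> (\<lambda>_. 0) = (back_diff (int m) ^^ length ws) (level_sum v \<alpha> (reciprocity_fun ws))"
      using level_sum_iter_diff[OF lf, of ws "int m"] step by (simp add: zero)
    moreover have "level_sum v \<alpha> (\<lambda>_. 0) = (\<lambda>_. 0)"
      by (simp add: level_sum_def fun_eq_iff)
    ultimately show ?thesis by (simp only: ls)
  qed
  with m(1) show ?thesis by blast
qed

section \<open>Quasi-polynomials\<close>

lemma back_diff_funpow_diff:
  "(back_diff m ^^ k) (\<lambda>d. f d - g d) = (\<lambda>d. (back_diff m ^^ k) f d - (back_diff m ^^ k) g d)"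
  by (induction k) (auto simp: fun_eq_iff back_diff_def)

lemma back_diff_funpow_vanish_below:
  assumes "m \<ge> 0" "\<And>d. d < l \<Longrightarrow> f d = 0" "d < l"
  shows "(back_diff m ^^ k) f d = 0"
  using assms(3) by (induction k arbitrary: d) (use assms(1,2) in \<open>auto simp: back_diff_def\<close>)

text \<open>Each difference looks back by m, so the upper bound of the support moves up by m each
  time.\<close>

lemma back_diff_funpow_vanish_above:
  assumes "\<And>d. d > u \<Longrightarrow> f d = 0" "d > u + int k * m" "m \<ge> 0"
  shows "(back_diff m ^^ k) f d = 0"
  using assms(2)
proof (induction k arbitrary: d)
  case (Suc k)
  then have "d - m > u + int k * m" by (simp add: algebra_simps)
  moreover from this assms(3) have "d > u + int k * m" by simp
  ultimately show ?case using Suc.IH by (simp add: back_diff_def)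
qed (use assms(1) in simp)

text \<open>The rising factorial x (x + 1) ... (x + n - 1), which behaves under the backward
  difference as x^n does under the derivative.\<close>

definition rising_poly :: "nat \<Rightarrow> 'a::comm_ring_1 poly" where
  "rising_poly n = (\<Prod>i<n. [:of_nat i, 1:])"

lemma rising_poly_diff:
  "poly (rising_poly (Suc n)) x - poly (rising_poly (Suc n)) (x - 1) = of_nat (Suc n) * poly (rising_poly n) x"
proof -
  have "poly (rising_poly (Suc n)) (x - 1) = (x - 1) * poly (rising_poly n) x"
    unfolding rising_poly_def prod.lessThan_Suc_shift by (simp add: poly_prod algebra_simps)
  moreover have "poly (rising_poly (Suc n)) x = (x + of_nat n) * poly (rising_poly n) x"
    unfolding rising_poly_def by (simp add: algebra_simps)
  ultimately show ?thesis by (simp add: algebra_simps)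
qed

lemma degree_rising_poly: "degree (rising_poly n :: 'a::idom poly) = n"
  unfolding rising_poly_def by (subst degree_prod_eq_sum_degree) auto

lemma lead_coeff_rising_poly: "coeff (rising_poly n :: 'a::idom poly) n = 1"
proof -
  have "lead_coeff (rising_poly n :: 'a poly) = 1"
    unfolding rising_poly_def by (simp add: lead_coeff_prod)
  then show ?thesis by (simp add: degree_rising_poly)
qed

text \<open>The leading term is cancelled by a multiple of \<open>rising_poly n\<close>, whose
  antidifference is \<open>rising_poly (Suc n)\<close> divided by n + 1; the rest follows by
  induction on the degree bound.\<close>

lemma poly_antidifference:
  fixes q :: "'a::field_char_0 poly"
  shows "\<exists>p. \<forall>x. poly p x - poly p (x - 1) = poly q x"
proof -
  have "\<exists>p. \<forall>x. poly p x - poly p (x - 1) = poly q x" if "\<forall>i\<ge>n. coeff q i = 0" for n and q :: "'a poly"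
    using that
  proof (induction n arbitrary: q)
    case 0
    then have "q = 0" by (simp add: poly_eq_iff)
    then show ?case by (intro exI[of _ 0]) simp
  next
    case (Suc n)
    define c where "c = coeff q n"
    have "coeff (q - smult c (rising_poly n)) i = 0" if "i \<ge> n" for i
    proof (cases "i = n")
      case True
      then show ?thesis by (simp add: c_def lead_coeff_rising_poly)
    next
      case False
      with that have "i > n" by simp
      then have "coeff (rising_poly n :: 'a poly) i = 0" by (intro coeff_eq_0) (simp add: degree_rising_poly)
      then show ?thesis using Suc.prems \<open>i > n\<close> by simp
    qed
    then obtain p where p: "\<forall>x. poly p x - poly p (x - 1) = poly (q - smult c (rising_poly n)) x"
      using Suc.IH by blast
    have "poly (p + smult (c / of_nat (Suc n)) (rising_poly (Suc n))) x -
        poly (p + smult (c / of_nat (Suc n)) (rising_poly (Suc n))) (x - 1) = poly q x" for x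
    proof -
      have "poly (p + smult (c / of_nat (Suc n)) (rising_poly (Suc n))) x -
          poly (p + smult (c / of_nat (Suc n)) (rising_poly (Suc n))) (x - 1) =
          (poly p x - poly p (x - 1)) + (c / of_nat (Suc n)) *
            (poly (rising_poly (Suc n)) x - poly (rising_poly (Suc n)) (x - 1))"
        unfolding poly_add poly_smult by (simp only: algebra_simps)
      also have "\<dots> = poly q x"
        unfolding rising_poly_diff p[rule_format] by (simp del: of_nat_Suc)
      finally show ?thesis .
    qed
    then show ?case by blast
  qed
  from this[of "Suc (degree q)" q] show ?thesis by (simp add: coeff_eq_0)
qed

lemma int_shift_invariant_const:
  fixes f :: "int \<Rightarrow> 'a"
  assumes "\<And>k. f k = f (k - 1)"
  shows "f k = f 0"
proof (induction k rule: int_induct[of _ 0])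
  case (step1 i)
  then show ?case using assms[of "i + 1"] by simp
next
  case (step2 i)
  then show ?case using assms[of i] by simp
qed simp

text \<open>By induction the first difference of a is a polynomial. Subtracting an antidifference of
  it leaves a function invariant under shift by 1, hence a constant.\<close>

lemma polynomial_of_back_diff_zero:
  fixes a :: "int \<Rightarrow> 'a::field_char_0"
  assumes "(back_diff 1 ^^ K) a = (\<lambda>_. 0)"
  shows "\<exists>p. \<forall>k. a k = poly p (of_int k)"
  using assms
proof (induction K arbitrary: a)
  case 0
  then show ?case by (intro exI[of _ 0]) simp
next
  case (Suc K)
  then have "(back_diff 1 ^^ K) (back_diff 1 a) = (\<lambda>_. 0)" by (simp add: funpow_swap1)
  with Suc.IH obtain q where q: "\<And>k. back_diff 1 a k = poly q (of_int k)" by blast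
  obtain p where p: "\<And>x. poly p x - poly p (x - 1) = poly q x" using poly_antidifference[of q] by blast
  define b where "b k = a k - poly p (of_int k)" for k
  have "b k = b (k - 1)" for k
    using q[of k] p[of "of_int k"] by (simp add: b_def back_diff_def algebra_simps)
  from int_shift_invariant_const[of b, OF this] have "b k = b 0" for k .
  then have "a k = poly (p + [:b 0:]) (of_int k)" for k
    by (simp add: b_def algebra_simps)
  then show ?case by blast
qed

lemma back_diff_funpow_progression:
  "(back_diff 1 ^^ K) (\<lambda>k. g (j + k * m)) = (\<lambda>k. (back_diff m ^^ K) g (j + k * m))"
  by (induction K) (auto simp: fun_eq_iff back_diff_def algebra_simps)

lemma quasi_polynomialI_back_diff:
  assumes "m \<ge> 1" "(back_diff (int m) ^^ K) g = (\<lambda>_. 0)"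
  shows "quasi_polynomial g"
proof -
  have "\<exists>p. \<forall>k. g (int j + k * int m) = poly p (of_int k)" for j
    by (rule polynomial_of_back_diff_zero[of K]) (simp add: back_diff_funpow_progression assms)
  then have "\<forall>j. \<exists>p. \<forall>k. g (int j + k * int m) = poly p (of_int k)" by blast
  from choice[OF this] obtain p where p: "\<And>j k. g (int j + k * int m) = poly (p j) (of_int k)" by blast
  \<comment> \<open>This substitutes k = (d - j) / m to pass from the position k in the residue
    class to the argument d.\<close>
  define Q where "Q j = pcompose (p j) [:- of_nat j / of_nat m, 1 / of_nat m:]" for j
  have "g d = poly (Q j) (of_int d)" if "[d = int j] (mod int m)" for j d
  proof -
    from that have "[int j = d] (mod int m)" by (rule cong_sym)
    then obtain k where k: "d = int j + k * int m" by (auto simp: cong_iff_lin mult.commute)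
    then have "(of_int d :: complex) = of_nat j + of_int k * of_nat m" by simp
    then have "poly [:- of_nat j / of_nat m, 1 / of_nat m:] (of_int d :: complex) = of_int k"
      using assms(1) by (simp add: add_divide_distrib)
    then show ?thesis
      unfolding Q_def poly_pcompose using p[of j k] k by (simp only:)
  qed
  then show ?thesis unfolding quasi_polynomial_def using assms(1) by blast
qed

section \<open>Uniqueness and closure properties of quasi-polynomials\<close>

lemma quasi_polynomial_progression:
  assumes "quasi_polynomial f"
  shows "\<exists>N\<ge>1. \<forall>d. \<exists>p. \<forall>k. f (d + k * int N) = poly p (of_int k)"
proof -
  obtain N Q where N: "N \<ge> 1" "\<forall>j<N. \<forall>m::int. [m = int j] (mod int N) \<longrightarrow> f m = poly (Q j) (of_int m)"
    using assms unfolding quasi_polynomial_def by blast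
  have "\<exists>p. \<forall>k. f (d + k * int N) = poly p (of_int k)" for d
  proof -
    define j where "j = nat (d mod int N)"
    have j: "j < N" "int j = d mod int N" using N(1) by (auto simp: j_def nat_less_iff)
    have "f (d + k * int N) = poly (pcompose (Q j) [:of_int d, of_nat N:]) (of_int k)" for k
      using N(2)[rule_format, OF j(1), of "d + k * int N"] j(2)
      by (simp add: cong_def poly_pcompose algebra_simps)
    then show ?thesis by blast
  qed
  with N(1) show ?thesis by blast
qed

text \<open>Along a progression through d whose step is a common multiple of both periods, f - g is
  a polynomial in k with infinitely many zeros, so it vanishes also at k = 0.\<close>

lemma quasi_polynomial_unique:
  assumes "quasi_polynomial f" "quasi_polynomial g"
    and "\<And>d::int. real_of_int d \<ge> c \<Longrightarrow> f d = g d"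
  shows "f = g"
proof
  fix d
  obtain N1 where N1: "N1 \<ge> 1" "\<forall>d. \<exists>p. \<forall>k. f (d + k * int N1) = poly p (of_int k)"
    using quasi_polynomial_progression[OF assms(1)] by blast
  obtain N2 where N2: "N2 \<ge> 1" "\<forall>d. \<exists>p. \<forall>k. g (d + k * int N2) = poly p (of_int k)"
    using quasi_polynomial_progression[OF assms(2)] by blast
  obtain p1 where p1: "\<And>k. f (d + k * int N1) = poly p1 (of_int k)" using N1 by blast
  obtain p2 where p2: "\<And>k. g (d + k * int N2) = poly p2 (of_int k)" using N2 by blast
  define r where "r = pcompose p1 [:0, of_nat N2:] - pcompose p2 [:0, of_nat N1:]"
  have r: "poly r (of_int k) = f (d + k * int N1 * int N2) - g (d + k * int N1 * int N2)" for k
    using p1[of "k * int N2"] p2[of "k * int N1"] by (simp add: r_def poly_pcompose mult_ac)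
  \<comment> \<open>As N1 N2 is at least 1, from n = K on the argument d + n N1 N2 is at least
    c.\<close>
  define K where "K = nat (\<lceil>c\<rceil> - d)"
  have "poly r (of_nat n) = 0" if "n \<ge> K" for n
  proof -
    have "int n * 1 \<le> int n * (int N1 * int N2)"
      using N1(1) N2(1) by (intro mult_left_mono) (auto simp flip: of_nat_mult simp: Suc_le_eq)
    moreover have "int n \<ge> \<lceil>c\<rceil> - d" using that by (simp add: K_def)
    ultimately have "\<lceil>c\<rceil> \<le> d + int n * int N1 * int N2" by (simp add: mult.assoc)
    then have "real_of_int (d + int n * int N1 * int N2) \<ge> c" by (simp only: ceiling_le_iff)
    then show ?thesis using r[of "int n"] assms(3) by simp
  qed
  then have "of_nat ` {K..} \<subseteq> {x. poly r x = 0}" by auto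
  moreover have "infinite (of_nat ` {K..} :: complex set)"
    by (subst finite_image_iff) (auto simp: inj_on_def infinite_Ici)
  ultimately have "infinite {x. poly r x = 0}" using finite_subset by blast
  then have "r = 0" using poly_roots_finite by blast
  with r[of 0] show "f d = g d" by simp
qed

lemma quasi_polynomial_reflect:
  assumes "quasi_polynomial f"
  shows "quasi_polynomial (\<lambda>d. f (- d))"
proof -
  obtain N Q where N: "N \<ge> 1" "\<forall>j<N. \<forall>m::int. [m = int j] (mod int N) \<longrightarrow> f m = poly (Q j) (of_int m)"
    using assms unfolding quasi_polynomial_def by blast
  define j' where "j' j = nat (- int j mod int N)" for j
  have j': "j' j < N" "int (j' j) = - int j mod int N" for j using N(1) by (auto simp: j'_def nat_less_iff)
  have "f (- m) = poly (pcompose (Q (j' j)) [:0, - 1:]) (of_int m)" if "[m = int j] (mod int N)" for m j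
  proof -
    have "[- m = - int j] (mod int N)" using that by (simp add: cong_minus_minus_iff)
    then have "[- m = int (j' j)] (mod int N)" by (simp add: j'(2) cong_def)
    then have "f (- m) = poly (Q (j' j)) (of_int (- m))" using N(2) j'(1) by blast
    then show ?thesis by (simp add: poly_pcompose)
  qed
  then show ?thesis unfolding quasi_polynomial_def using N(1)
    by (intro exI[of _ N] exI[of _ "\<lambda>j. pcompose (Q (j' j)) [:0, - 1:]"]) blast
qed

lemma quasi_polynomial_cmult:
  assumes "quasi_polynomial f"
  shows "quasi_polynomial (\<lambda>d. c * f d)"
proof -
  obtain N Q where N: "N \<ge> 1" "\<forall>j<N. \<forall>m::int. [m = int j] (mod int N) \<longrightarrow> f m = poly (Q j) (of_int m)"
    using assms unfolding quasi_polynomial_def by blast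
  then show ?thesis unfolding quasi_polynomial_def
    by (intro exI[of _ N] exI[of _ "\<lambda>j. smult c (Q j)"]) simp
qed

section \<open>Rational generating functions\<close>

abbreviation fls_of_poly :: "complex poly \<Rightarrow> complex fls" where
  "fls_of_poly p \<equiv> fps_to_fls (fps_of_poly p)"

lemma fls_of_poly_mult: "fls_of_poly (p * q) = fls_of_poly p * fls_of_poly q"
  by (simp add: fps_of_poly_mult fls_times_fps_to_fls)

lemma fls_of_poly_power: "fls_of_poly (p ^ n) = fls_of_poly p ^ n"
  by (simp add: fps_of_poly_power fps_to_fls_power)

lemma fls_of_poly_X: "fls_of_poly [:0, 1:] = fls_X"
  by (simp add: fps_of_poly_pCons)

text \<open>The reduced fraction a/b satisfies a q = p b, and multiplicativity carries this identity
  over to Laurent series; so any representation may be used.\<close>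

lemma ratfun_to_fls_Fract:
  assumes "q \<noteq> 0"
  shows "ratfun_to_fls (Fract p q) = fls_of_poly p / fls_of_poly q"
proof -
  obtain a b where ab: "quot_of_fract (Fract p q) = (a, b)" by (cases "quot_of_fract (Fract p q)")
  have b: "b \<noteq> 0" using snd_quot_of_fract_nonzero[of "Fract p q"] ab by simp
  have "Fract a b = Fract p q" using Fract_quot_of_fract[of "Fract p q"] ab by simp
  then have "a * q = p * b" using b assms by (simp add: eq_fract)
  then have "fls_of_poly a * fls_of_poly q = fls_of_poly p * fls_of_poly b"
    by (metis fls_of_poly_mult)
  then show ?thesis using b assms by (simp add: ratfun_to_fls_def ab frac_eq_eq)
qed

section \<open>Substituting 1/t in polynomials and rational functions\<close>

lemma poly_at_inverse_t_pCons:
  "poly_at_inverse_t (pCons c p) = to_fract [:c:] + (1 / to_fract [:0, 1:]) * poly_at_inverse_t p"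
  by (simp add: poly_at_inverse_t_def map_poly_pCons)

lemma poly_at_inverse_t_0: "poly_at_inverse_t 0 = 0"
  by (simp add: poly_at_inverse_t_def)

lemma poly_at_inverse_t_add: "poly_at_inverse_t (p + q) = poly_at_inverse_t p + poly_at_inverse_t q"
proof (induction p q rule: poly_induct2)
  case (pCons a p b q)
  have "to_fract [:a + b:] = to_fract [:a:] + to_fract [:b:]"
    by (simp flip: to_fract_add)
  then show ?case by (simp add: poly_at_inverse_t_pCons pCons algebra_simps add_divide_distrib)
qed (simp add: poly_at_inverse_t_0)

lemma poly_at_inverse_t_smult: "poly_at_inverse_t (smult c p) = to_fract [:c:] * poly_at_inverse_t p"
proof (induction p)
  case (pCons a p)
  have "to_fract [:c * a:] = to_fract [:c:] * to_fract [:a:]"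
    by (simp flip: to_fract_mult)
  then show ?case by (simp add: poly_at_inverse_t_pCons pCons algebra_simps)
qed (simp add: poly_at_inverse_t_0)

lemma poly_at_inverse_t_mult: "poly_at_inverse_t (p * q) = poly_at_inverse_t p * poly_at_inverse_t q"
  by (induction p)
    (simp_all add: poly_at_inverse_t_pCons poly_at_inverse_t_0 poly_at_inverse_t_add poly_at_inverse_t_smult algebra_simps)

lemma poly_at_inverse_t_1: "poly_at_inverse_t 1 = 1"
  by (simp add: poly_at_inverse_t_def flip: one_pCons)

lemma poly_at_inverse_t_power: "poly_at_inverse_t (p ^ n) = poly_at_inverse_t p ^ n"
  by (induction n) (simp_all add: poly_at_inverse_t_1 poly_at_inverse_t_mult)

lemma poly_at_inverse_t_X: "poly_at_inverse_t [:0, 1:] = 1 / to_fract [:0, 1:]"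
  by (simp add: poly_at_inverse_t_pCons poly_at_inverse_t_1 flip: one_pCons)

lemma to_fract_power: "to_fract (p ^ n) = to_fract p ^ n"
  by (induction n) simp_all

text \<open>Multiplying p(1/t) by t^n turns t^(-i) into t^(n - i), which reverses the coefficients;
  n may exceed the degree.\<close>

lemma poly_at_inverse_t_reverse:
  assumes "degree p \<le> n"
  shows "poly_at_inverse_t p * to_fract [:0, 1:] ^ n = to_fract (\<Sum>i\<le>n. monom (coeff p i) (n - i))"
proof -
  define X :: "complex poly fract" where "X = to_fract [:0, 1:]"
  have "X \<noteq> 0" by (simp add: X_def)
  define q where "q = map_poly (\<lambda>c. to_fract [:c:]) p"
  have deg: "degree q \<le> n"
    unfolding q_def using assms by (meson map_poly_degree_leq order_trans)
  have "poly q (1 / X) = (\<Sum>i\<le>n. coeff q i * (1 / X) ^ i)"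
    unfolding poly_altdef using deg by (intro sum.mono_neutral_left) (auto simp: coeff_eq_0)
  then have "poly_at_inverse_t p = (\<Sum>i\<le>n. to_fract [:coeff p i:] * (1 / X) ^ i)"
    by (simp add: poly_at_inverse_t_def X_def q_def coeff_map_poly)
  then have "poly_at_inverse_t p * X ^ n = (\<Sum>i\<le>n. to_fract [:coeff p i:] * ((1 / X) ^ i * X ^ n))"
    by (simp add: sum_distrib_right mult.assoc)
  also have "\<dots> = (\<Sum>i\<le>n. to_fract (monom (coeff p i) (n - i)))"
  proof (intro sum.cong refl)
    fix i assume "i \<in> {..n}"
    then have "X ^ n = X ^ i * X ^ (n - i)" by (simp flip: power_add)
    then have "(1 / X) ^ i * X ^ n = X ^ (n - i)" using \<open>X \<noteq> 0\<close> by (simp add: power_divide)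
    also have "\<dots> = to_fract ([:0, 1:] ^ (n - i))" by (simp add: X_def to_fract_power)
    also have "to_fract [:coeff p i:] * \<dots> = to_fract (monom (coeff p i) (n - i))"
      by (simp add: monom_altdef flip: to_fract_mult)
    finally show "to_fract [:coeff p i:] * ((1 / X) ^ i * X ^ n) = to_fract (monom (coeff p i) (n - i))" .
  qed
  finally show ?thesis by (simp add: X_def)
qed

text \<open>The reversed polynomial has the leading coefficient of p as its constant term.\<close>

lemma poly_at_inverse_t_nonzero:
  assumes "p \<noteq> 0"
  shows "poly_at_inverse_t p \<noteq> 0"
proof
  assume "poly_at_inverse_t p = 0"
  then have "(\<Sum>i\<le>degree p. monom (coeff p i) (degree p - i)) = 0"
    using poly_at_inverse_t_reverse[of p "degree p"] by (metis order_refl mult_zero_left to_fract_eq_0_iff)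
  then have "coeff (\<Sum>i\<le>degree p. monom (coeff p i) (degree p - i)) 0 = 0" by simp
  moreover have "coeff (\<Sum>i\<le>degree p. monom (coeff p i) (degree p - i)) 0 =
      (\<Sum>i\<le>degree p. if i = degree p then coeff p i else 0)"
    unfolding coeff_sum by (intro sum.cong) auto
  ultimately show False using assms by simp
qed

lemma ratfun_at_inverse_t_Fract:
  assumes "q \<noteq> 0"
  shows "ratfun_at_inverse_t (Fract p q) = poly_at_inverse_t p / poly_at_inverse_t q"
proof -
  obtain a b where ab: "quot_of_fract (Fract p q) = (a, b)" by (cases "quot_of_fract (Fract p q)")
  have b: "b \<noteq> 0" using snd_quot_of_fract_nonzero[of "Fract p q"] ab by simp
  have "Fract a b = Fract p q" using Fract_quot_of_fract[of "Fract p q"] ab by simp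
  then have "a * q = p * b" using b assms by (simp add: eq_fract)
  then have "poly_at_inverse_t a * poly_at_inverse_t q = poly_at_inverse_t p * poly_at_inverse_t b"
    by (metis poly_at_inverse_t_mult)
  then show ?thesis
    using b assms by (simp add: ratfun_at_inverse_t_def ab frac_eq_eq poly_at_inverse_t_nonzero)
qed

section \<open>Differences of coefficients as products of Laurent series\<close>

lemma fls_nth_back_diff:
  fixes F :: "complex fls"
  shows "fls_nth ((1 - fls_X ^ m) ^ k * F) d = (back_diff (int m) ^^ k) (fls_nth F) d"
proof (induction k arbitrary: d)
  case (Suc k)
  have "(1 - fls_X ^ m) ^ Suc k * F = (1 - fls_X ^ m) ^ k * F - fls_X ^ m * ((1 - fls_X ^ m) ^ k * F)"
    by (simp add: algebra_simps)
  then show ?case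
    by (simp add: fls_X_power_times_conv_shift(1) Suc back_diff_def)
qed simp

text \<open>On reflected coefficients X^m - 1 takes the place of 1 - X^m, and each factor moves the
  index by m, whence the offset k m.\<close>

lemma fls_nth_back_diff_reflected:
  fixes F :: "complex fls"
  shows "fls_nth ((fls_X ^ m - 1) ^ k * F) (int (k * m) - d) = (back_diff (int m) ^^ k) (\<lambda>d. fls_nth F (- d)) d"
proof (induction k arbitrary: d)
  case (Suc k)
  have "(fls_X ^ m - 1) ^ Suc k * F = fls_X ^ m * ((fls_X ^ m - 1) ^ k * F) - (fls_X ^ m - 1) ^ k * F"
    by (simp add: algebra_simps)
  then have "fls_nth ((fls_X ^ m - 1) ^ Suc k * F) i =
      fls_nth ((fls_X ^ m - 1) ^ k * F) (i - int m) - fls_nth ((fls_X ^ m - 1) ^ k * F) i" for i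
    by (simp only: fls_X_power_times_conv_shift(1) fls_minus_nth fls_shift_nth) simp
  moreover have "int (Suc k * m) - d - int m = int (k * m) - d"
      "int (Suc k * m) - d = int (k * m) - (d - int m)"
    by (simp_all add: algebra_simps)
  ultimately show ?case
    using Suc[of d] Suc[of "d - int m"] by (simp only: funpow.simps o_apply back_diff_def[of _ _ d])
qed simp

text \<open>The k-th differences of the coefficients of A and of the reflected signed coefficients
  of B are one sequence c. It vanishes far below because A is a Laurent series and far above because
  B is one. So c is finite, and gives the numerators of both rational functions.\<close>

lemma rational_reciprocity:
  fixes A B :: "complex fls"
  assumes m: "m \<ge> 1"
    and zero: "(back_diff (int m) ^^ k) (\<lambda>d. fls_nth A d - (- 1) ^ e * fls_nth B (- d)) = (\<lambda>_. 0)"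
  shows "\<exists>R R'. ratfun_to_fls R = A \<and> ratfun_to_fls R' = B \<and> ratfun_at_inverse_t R = (- 1) ^ e * R'"
proof -
  define sB where "sB = (- 1) ^ e * B"
  define c where "c = (back_diff (int m) ^^ k) (fls_nth A)"
  have sB: "fls_nth sB d = (- 1) ^ e * fls_nth B d" for d
    unfolding sB_def by (cases "even e") simp_all
  have c_A: "fls_nth ((1 - fls_X ^ m) ^ k * A) d = c d" for d
    by (simp add: fls_nth_back_diff c_def)
  have c_eq: "c = (back_diff (int m) ^^ k) (\<lambda>d. fls_nth sB (- d))"
    using zero unfolding sB[symmetric] back_diff_funpow_diff c_def by (simp add: fun_eq_iff)
  have c_B: "fls_nth ((fls_X ^ m - 1) ^ k * sB) i = c (int (k * m) - i)" for i
    using fls_nth_back_diff_reflected[of m k sB "int (k * m) - i"] by (simp add: c_eq)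
  \<comment> \<open>The support of c starts no lower than the subdegree of A and ends at most k m
    above the negated subdegree of \<open>sB\<close>; n is chosen so that it lies in
    [-n, n].\<close>
  define n where "n = nat \<bar>fls_subdegree A\<bar> + nat \<bar>fls_subdegree sB\<bar> + k * m"
  have n: "int n = \<bar>fls_subdegree A\<bar> + \<bar>fls_subdegree sB\<bar> + int k * int m" by (simp add: n_def)
  have km: "int k * int m \<ge> 0" by simp
  have low: "c d = 0" if "d < - int n" for d
    unfolding c_def
  proof (rule back_diff_funpow_vanish_below[of _ "fls_subdegree A"])
    show "d < fls_subdegree A" using that n km by linarith
  qed auto
  have high: "c d = 0" if "d > int n" for d
    unfolding c_eq
  proof (rule back_diff_funpow_vanish_above[of "- fls_subdegree sB"])
    show "- fls_subdegree sB + int k * int m < d" using that n km by linarith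
  qed auto
  define X :: "complex poly" where "X = [:0, 1:]"
  \<comment> \<open>The sequence c, shifted by n to start at index 0, gives p; \<open>p'\<close> is
    its reversal of length 2 n.\<close>
  define p where "p = (\<Sum>i\<le>2 * n. monom (c (int i - int n)) i)"
  define p' where "p' = (\<Sum>i\<le>2 * n. monom (c (int i - int n)) (2 * n - i))"
  have coeff_p: "coeff p i = c (int i - int n)" for i
    using high[of "int i - int n"] by (auto simp: p_def coeff_sum)
  have coeff_p': "coeff p' j = (if j \<le> 2 * n then c (int n - int j) else 0)" for j
  proof -
    have "coeff p' j = (\<Sum>i\<le>2 * n. if i = 2 * n - j \<and> j \<le> 2 * n then c (int i - int n) else 0)"
      unfolding p'_def coeff_sum by (intro sum.cong) auto
    then show ?thesis by (auto simp: of_nat_diff algebra_simps)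
  qed
  have deg_p: "degree p \<le> 2 * n"
    by (intro degree_le) (auto simp: coeff_p intro: high)
  have rev_p: "poly_at_inverse_t p * to_fract X ^ (2 * n) = to_fract p'"
    unfolding X_def poly_at_inverse_t_reverse[OF deg_p] p'_def coeff_p ..
  have nth_p: "fls_nth (fls_of_poly p) j = c (j - int n)" for j
    using low[of "j - int n"] by (auto simp: coeff_p)
  have nth_p': "fls_nth (fls_of_poly p') j = c (int n - j)" for j
    using high[of "int n - j"] low[of "int n - j"] by (auto simp: coeff_p')
  have X: "X \<noteq> 0" by (simp add: X_def)
  have "X ^ m \<noteq> 1"
  proof
    assume "X ^ m = 1"
    then have "poly (X ^ m) 0 = 1" by simp
    then show False using m by (simp add: X_def zero_power)
  qed
  then have nz: "X ^ n * (1 - X ^ m) ^ k \<noteq> 0" "X ^ n * (X ^ m - 1) ^ k \<noteq> 0" using X by auto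
  \<comment> \<open>The factor X^n undoes the shift in p. In \<open>R'\<close> the factor X^(m k)
    arises because 1 - t^(-m) is (t^m - 1) / t^m.\<close>
  define R where "R = Fract p (X ^ n * (1 - X ^ m) ^ k)"
  define R' where "R' = Fract ((- 1) ^ e * (X ^ (m * k) * p')) (X ^ n * (X ^ m - 1) ^ k)"
  have hom: "fls_of_poly (X ^ i) = fls_X ^ i" for i
    by (simp only: X_def fls_of_poly_power fls_of_poly_X)
  have one: "fls_of_poly 1 = 1" by simp
  have "ratfun_to_fls R = A"
  proof -
    have "fls_of_poly (X ^ n * (1 - X ^ m) ^ k) = fls_X ^ n * (1 - fls_X ^ m) ^ k"
      by (simp only: fls_of_poly_mult fls_of_poly_power[of "1 - X ^ m"] fps_of_poly_diff fps_to_fls_minus one hom)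
    moreover have "fls_of_poly p = fls_X ^ n * ((1 - fls_X ^ m) ^ k * A)"
      by (rule fls_eqI) (simp add: fls_X_power_times_conv_shift(1) c_A nth_p del: fps_to_fls_nth)
    moreover have "fls_of_poly (X ^ n * (1 - X ^ m) ^ k) \<noteq> 0" using nz(1) by simp
    ultimately show ?thesis
      unfolding R_def ratfun_to_fls_Fract[OF nz(1)] by (simp add: mult.assoc[symmetric])
  qed
  moreover have "ratfun_to_fls R' = B"
  proof -
    have den: "fls_of_poly (X ^ n * (X ^ m - 1) ^ k) = fls_X ^ n * (fls_X ^ m - 1) ^ k"
      by (simp only: fls_of_poly_mult fls_of_poly_power[of "X ^ m - 1"] fps_of_poly_diff fps_to_fls_minus one hom)
    have "fls_X ^ (m * k) * fls_of_poly p' = fls_X ^ n * ((fls_X ^ m - 1) ^ k * sB)"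
    proof (rule fls_eqI)
      fix j
      have "fls_nth (fls_X ^ (m * k) * fls_of_poly p') j = c (int n - (j + - int (m * k)))"
        by (simp only: fls_X_power_times_conv_shift(1) fls_shift_nth nth_p')
      moreover have "fls_nth (fls_X ^ n * ((fls_X ^ m - 1) ^ k * sB)) j = c (int (k * m) - (j + - int n))"
        by (simp only: fls_X_power_times_conv_shift(1) fls_shift_nth c_B)
      moreover have "int n - (j + - int (m * k)) = int (k * m) - (j + - int n)" by (simp add: algebra_simps)
      ultimately show "fls_nth (fls_X ^ (m * k) * fls_of_poly p') j =
          fls_nth (fls_X ^ n * ((fls_X ^ m - 1) ^ k * sB)) j" by (simp only:)
    qed
    then have "(- 1) ^ e * (fls_X ^ (m * k) * fls_of_poly p') = fls_X ^ n * (fls_X ^ m - 1) ^ k * B"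
      unfolding sB_def by (cases "even e") simp_all
    moreover have "fls_of_poly ((- 1) ^ e * (X ^ (m * k) * p')) = (- 1) ^ e * (fls_X ^ (m * k) * fls_of_poly p')"
    proof -
      have "fls_of_poly ((- 1) ^ e) = (- 1) ^ e" by (cases "even e") (simp_all add: fps_of_poly_uminus)
      then show ?thesis by (simp only: fls_of_poly_mult hom)
    qed
    moreover have "fls_of_poly (X ^ n * (X ^ m - 1) ^ k) \<noteq> 0" using nz(2) by simp
    ultimately show ?thesis
      unfolding R'_def ratfun_to_fls_Fract[OF nz(2)] by (simp add: den)
  qed
  moreover have "ratfun_at_inverse_t R = (- 1) ^ e * R'"
  proof -
    define Y where "Y = to_fract X"
    have Y: "Y \<noteq> 0" using X by (simp add: Y_def)
    have Ym: "Y ^ m - 1 \<noteq> 0"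
      using \<open>X ^ m \<noteq> 1\<close> by (metis Y_def eq_iff_diff_eq_0 to_fract_1 to_fract_eq_iff to_fract_power)
    have "poly_at_inverse_t (1 - X ^ m) = 1 - (1 / Y) ^ m"
    proof -
      have "poly_at_inverse_t ((1 - X ^ m) + X ^ m) = poly_at_inverse_t (1 - X ^ m) + (1 / Y) ^ m"
        unfolding poly_at_inverse_t_add poly_at_inverse_t_power by (simp add: X_def poly_at_inverse_t_X Y_def)
      then show ?thesis by (simp add: poly_at_inverse_t_1 eq_diff_eq)
    qed
    also have "\<dots> = (Y ^ m - 1) / Y ^ m" using Y by (simp add: field_simps power_divide)
    finally have "poly_at_inverse_t (X ^ n * (1 - X ^ m) ^ k) = (1 / Y) ^ n * ((Y ^ m - 1) / Y ^ m) ^ k"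
      unfolding poly_at_inverse_t_mult poly_at_inverse_t_power by (simp add: X_def poly_at_inverse_t_X Y_def)
    moreover have "poly_at_inverse_t p = to_fract p' / (Y ^ n * Y ^ n)"
    proof -
      have "poly_at_inverse_t p * (Y ^ n * Y ^ n) = to_fract p'"
        using rev_p by (simp only: Y_def mult_2 power_add)
      then show ?thesis using Y by (simp add: eq_divide_eq)
    qed
    ultimately have "ratfun_at_inverse_t R =
        (to_fract p' / (Y ^ n * Y ^ n)) / ((1 / Y) ^ n * ((Y ^ m - 1) / Y ^ m) ^ k)"
      unfolding R_def ratfun_at_inverse_t_Fract[OF nz(1)] by simp
    also have "\<dots> = (Y ^ (m * k) * to_fract p') / (Y ^ n * (Y ^ m - 1) ^ k)"
    proof -
      \<comment> \<open>Here a, b and z stand for Y^n, Y^(m k) and (Y^m - 1)^k.\<close>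
      have "(T / (a * a)) / ((1 / a) * (z / b)) = (b * T) / (a * z)"
        if "a \<noteq> 0" "b \<noteq> 0" "z \<noteq> 0" for T a b z :: "complex poly fract"
        using that by (simp add: field_simps)
      from this[of "Y ^ n" "Y ^ (m * k)" "(Y ^ m - 1) ^ k" "to_fract p'"] show ?thesis
        using Y Ym by (simp only: power_divide power_one power_mult power_not_zero not_False_eq_True)
    qed
    also have "\<dots> = (- 1) ^ e * R'"
    proof -
      have "R' = ((- 1) ^ e * (Y ^ (m * k) * to_fract p')) / (Y ^ n * (Y ^ m - 1) ^ k)"
        unfolding R'_def Fract_conv_to_fract by (simp add: to_fract_power Y_def)
      then show ?thesis by (cases "even e") simp_all
    qed
    finally show ?thesis .
  qed
  ultimately show ?thesis by blast
qed

section \<open>Reciprocity\<close>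

theorem theoremC4:
  fixes P :: "(real ^ 'n) set" and v :: "real ^ 'n" and \<alpha> :: real and M :: nat
  assumes "rational_polytope P" and "aff_dim P = int M"
  shows
    "(quasi_polynomial_on {d. real_of_int d \<ge> - \<alpha>} (\<lambda>d. of_nat (count_pts P v \<alpha> d)) \<and>
      (\<forall>d::int. real_of_int d < - \<alpha> \<longrightarrow> count_pts P v \<alpha> d = 0)) \<and>
     (quasi_polynomial_on {d. real_of_int d > - \<alpha>} (\<lambda>d. of_nat (count_relint_pts P v \<alpha> d)) \<and>
      (\<forall>d::int. real_of_int d \<le> - \<alpha> \<longrightarrow> count_relint_pts P v \<alpha> d = 0)) \<and>
     (\<exists>R R'. ratfun_to_fls R = gen_series P v \<alpha> \<and>
             ratfun_to_fls R' = gen_series_relint P (- v) (- \<alpha>) \<and>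
             ratfun_at_inverse_t R = (- 1) ^ (M + 1) * R') \<and>
     (\<forall>f. quasi_polynomial f \<and>
          (\<forall>d::int. real_of_int d \<ge> - \<alpha> \<longrightarrow> f d = of_nat (count_pts P v \<alpha> d)) \<longrightarrow>
          (\<forall>i::int. real_of_int i > \<alpha> \<longrightarrow>
             f (- i) = (- 1) ^ M * of_nat (count_relint_pts P (- v) (- \<alpha>) i)))"
proof -
  have vanish: "count_pts P v \<alpha> d = 0" if "real_of_int d < - \<alpha>" for v \<alpha> and d :: int
    using that by (simp add: count_pts_def dilate_def)
  have vanish_relint: "count_relint_pts P v \<alpha> d = 0" if "real_of_int d \<le> - \<alpha>" for v \<alpha> and d :: int
    using that by (simp add: count_relint_pts_def dilate_relint_def)
  \<comment> \<open>The two terms have disjoint supports: d \<ge> - \<alpha> for the first and d < -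
    \<alpha> for the second. The boundary d = - \<alpha> belongs to the closed polytope, as the
    dilated relative interior is empty at factor 0. Thus g is the quasi-polynomial of the closed
    counts, and its values further down are the signed interior counts.\<close>
  define g :: "real ^ 'n \<Rightarrow> real \<Rightarrow> int \<Rightarrow> complex" where
    "g v \<alpha> d = of_nat (count_pts P v \<alpha> d) - (- 1) ^ (M + 1) * of_nat (count_relint_pts P (- v) (- \<alpha>) (- d))" for v \<alpha> d
  obtain m k where m: "m \<ge> 1" and zero: "\<And>v \<alpha>. (back_diff (int m) ^^ k) (\<lambda>d. real (count_pts P v \<alpha> d) -
      (- 1) ^ (M + 1) * real (count_relint_pts P (- v) (- \<alpha>) (- d))) = (\<lambda>_. 0)"
    using back_diff_reciprocity[OF assms] by blast
  have of_real: "(back_diff (int m) ^^ k) (\<lambda>d. complex_of_real (f d)) = (\<lambda>d. of_real ((back_diff (int m) ^^ k) f d))" for f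
    by (induction k) (auto simp: back_diff_def fun_eq_iff)
  have g_zero: "(back_diff (int m) ^^ k) (g v \<alpha>) = (\<lambda>_. 0)" for v \<alpha>
  proof -
    have "g v \<alpha> = (\<lambda>d. complex_of_real (real (count_pts P v \<alpha> d) -
      (- 1) ^ (M + 1) * real (count_relint_pts P (- v) (- \<alpha>) (- d))))"
      by (simp add: g_def fun_eq_iff)
    then show ?thesis by (simp only: of_real zero of_real_0)
  qed
  have qp: "quasi_polynomial (g v \<alpha>)" for v \<alpha>
    using quasi_polynomialI_back_diff[OF m g_zero] .
  have g_nonneg: "g v \<alpha> d = of_nat (count_pts P v \<alpha> d)" if "real_of_int d \<ge> - \<alpha>" for v \<alpha> d
    using vanish_relint[of "- d" "- \<alpha>" "- v"] that by (simp add: g_def)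
  have g_neg: "g v \<alpha> (- i) = (- 1) ^ M * of_nat (count_relint_pts P (- v) (- \<alpha>) i)" if "real_of_int i > \<alpha>" for v \<alpha> i
    using vanish[of "- i" \<alpha> v] that by (simp add: g_def)
  have "quasi_polynomial_on {d. real_of_int d \<ge> - \<alpha>} (\<lambda>d. of_nat (count_pts P v \<alpha> d))"
    unfolding quasi_polynomial_on_def using qp g_nonneg by (metis mem_Collect_eq)
  moreover have "quasi_polynomial_on {d. real_of_int d > - \<alpha>} (\<lambda>d. of_nat (count_relint_pts P v \<alpha> d))"
    unfolding quasi_polynomial_on_def
  proof (intro exI conjI ballI)
    \<comment> \<open>The interior counts for v and \<alpha> are the lower half of the
      quasi-polynomial for - v and - \<alpha>, reflected and with the sign removed.\<close>
    show "quasi_polynomial (\<lambda>d. (- 1) ^ M * g (- v) (- \<alpha>) (- d))"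
      by (intro quasi_polynomial_cmult quasi_polynomial_reflect[of "g (- v) (- \<alpha>)"] qp)
    fix d assume "d \<in> {d. real_of_int d > - \<alpha>}"
    then show "of_nat (count_relint_pts P v \<alpha> d) = (- 1) ^ M * g (- v) (- \<alpha>) (- d)"
      using g_neg[of "- \<alpha>" d "- v"] by (cases "even M") simp_all
  qed
  moreover have "\<exists>R R'. ratfun_to_fls R = gen_series P v \<alpha> \<and>
      ratfun_to_fls R' = gen_series_relint P (- v) (- \<alpha>) \<and>
      ratfun_at_inverse_t R = (- 1) ^ (M + 1) * R'"
  proof (rule rational_reciprocity[OF m])
    have "(\<lambda>d. fls_nth (gen_series P v \<alpha>) d - (- 1) ^ (M + 1) * fls_nth (gen_series_relint P (- v) (- \<alpha>)) (- d)) = g v \<alpha>"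
      by (simp add: g_def fun_eq_iff gen_series.rep_eq gen_series_relint.rep_eq)
    then show "(back_diff (int m) ^^ k) (\<lambda>d. fls_nth (gen_series P v \<alpha>) d -
        (- 1) ^ (M + 1) * fls_nth (gen_series_relint P (- v) (- \<alpha>)) (- d)) = (\<lambda>_. 0)"
      by (simp only: g_zero)
  qed
  moreover have "f (- i) = (- 1) ^ M * of_nat (count_relint_pts P (- v) (- \<alpha>) i)"
    if "quasi_polynomial f" "\<forall>d::int. real_of_int d \<ge> - \<alpha> \<longrightarrow> f d = of_nat (count_pts P v \<alpha> d)"
      "real_of_int i > \<alpha>" for f i
  proof -
    \<comment> \<open>Both agree with the closed counts from - \<alpha> on, and this determines a
      quasi-polynomial.\<close>
    have "f = g v \<alpha>"
      using quasi_polynomial_unique[OF that(1) qp[of v \<alpha>], of "- \<alpha>"] that(2) g_nonneg by simp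
    then show ?thesis using g_neg[OF that(3)] by simp
  qed
  ultimately show ?thesis using vanish vanish_relint by blast
qed

end
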